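(* Consider the six-spin interaction model $\mu_n(\omega)\propto\exp(nf_{\beta,h}(\bar\omega_+))$, $\omega\in\{1,-1\}^n$, with $f_{\beta,h}(a)=\beta(2a-1)^6+h(2a-1)^5+(2a-1)^2/2$ and, with $t_*=0.9$, $$\beta=\frac{\frac32t_*^2+5E(t_* )-t_*E'(t_* )}{t_*^6},\qquad h=\frac{-2t_*^2-6E(t_* )+t_*E'(t_* )}{t_*^5},$$ where $E(t)=-\frac{1+t}{2}\log(1+t)-\frac{1-t}{2}\log(1-t)$. Then the associated function $A=f_{\beta,h}+I$ on $[0,1]$ has two maximizers $1/2$ and $0.95$, where $1/2$ is 4-regular and $0.95$ is 2-regular. As a consequence, as $n\to\infty$, $$M_n/n\to0\quad\text{in law},\qquad M_n=\omega_1+\dots+\omega_n.$$ Moreover, for every sufficiently small constant $\delta>0$, $$d_{\mathrm W}\Big(\mathcal L\big(n^{-3/4}M_n\,\big|\,\bar\omega_+\in(\tfrac12-\delta,\tfrac12+\delta)\big),\,Y\Big)=O(n^{-1/4}),$$ where $Y$ has density proportional to $\exp\Big(\frac{A^{(4)}(1/2)\,x^4}{2^4\,4!}\Big)$, and $$d_{\mathrm W}\Big(\mathcal L\big(W_n\,\big|\,\bar\omega_+\in(0.95-\delta,0.95+\delta)\big),\,N\Big(0,\frac{4}{|A''(0.95)|}\Big)\Big)=O(n^{-1/2}),\qquad W_n=\frac{M_n-0.9n}{\sqrt n}.$$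
   Context: For $\omega\in\{1,-1\}^n$, $\bar\omega_+=|\{i:\omega_i=1\}|/n$. $I(a)=-a\log a-(1-a)\log(1-a)$ on $[0,1]$ ($0\log0=0$). A maximizer $a\in(0,1)$ of $A$ is $2m$-regular if $A^{(k)}(a)=0$ for $1\le k\le2m-1$ and $A^{(2m)}(a)<0$. $d_{\mathrm W}(X,Y)=\sup_{\|h'\|_\infty\le1}|\mathbb Eh(X)-\mathbb Eh(Y)|$; $N(0,\sigma^2)$ is the centered normal law with variance $\sigma^2$; $\mathcal L(\cdot\mid\cdot)$ is a conditional law under $\mu_n$. Constants in $O(\cdot)$ do not depend on $n$. *)

theory Defs
  imports "HOL-Probability.Probability"
begin

text \<open>Configurations are functions supported on \<open>{1..n}\<close> (extensional elsewhere), so that \<open>n\<close> may vary.\<close>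

definition configs :: "nat \<Rightarrow> (nat \<Rightarrow> real) set" where
  "configs n = {1..n} \<rightarrow>\<^sub>E {1, -1}"

definition frac_plus :: "nat \<Rightarrow> (nat \<Rightarrow> real) \<Rightarrow> real" where
  "frac_plus n \<omega> = real (card {i \<in> {1..n}. \<omega> i = 1}) / real n"

definition magnetization :: "nat \<Rightarrow> (nat \<Rightarrow> real) \<Rightarrow> real" where
  "magnetization n \<omega> = (\<Sum>i=1..n. \<omega> i)"

definition gibbs :: "(real \<Rightarrow> real) \<Rightarrow> nat \<Rightarrow> (nat \<Rightarrow> real) measure" where
  "gibbs f n = point_measure (configs n)
     (\<lambda>\<omega>. ennreal (exp (real n * f (frac_plus n \<omega>)) /
                   (\<Sum>\<eta>\<in>configs n. exp (real n * f (frac_plus n \<eta>)))))"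

text \<open>The conditional law of \<open>X\<close> given that \<open>frac_plus n\<close> lies in \<open>S\<close>. If this event is empty,
  the result is the null measure rather than a probability measure.\<close>

definition cond_law ::
  "(real \<Rightarrow> real) \<Rightarrow> nat \<Rightarrow> real set \<Rightarrow> ((nat \<Rightarrow> real) \<Rightarrow> real) \<Rightarrow> real measure" where
  "cond_law f n S X =
     distr (uniform_measure (gibbs f n) {\<omega> \<in> configs n. frac_plus n \<omega> \<in> S}) borel X"

text \<open>Since \<open>ln 0 = 0\<close>, the convention \<open>0 log 0 = 0\<close> is built in.\<close>

definition entropy_I :: "real \<Rightarrow> real" where
  "entropy_I a = - a * ln a - (1 - a) * ln (1 - a)"

definition entropy_E :: "real \<Rightarrow> real" where
  "entropy_E t = - (1 + t) / 2 * ln (1 + t) - (1 - t) / 2 * ln (1 - t)"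

definition six_spin :: "real \<Rightarrow> real \<Rightarrow> real \<Rightarrow> real" where
  "six_spin \<beta> h a = \<beta> * (2 * a - 1) ^ 6 + h * (2 * a - 1) ^ 5 + (2 * a - 1)\<^sup>2 / 2"

definition maximizers :: "(real \<Rightarrow> real) \<Rightarrow> real set" where
  "maximizers A = {a \<in> {0..1}. \<forall>b\<in>{0..1}. A b \<le> A a}"

text \<open>\<open>regular_maximizer A m a\<close>: the point \<open>a\<close> is a \<open>2m\<close>-regular maximizer of \<open>A\<close>.\<close>

definition regular_maximizer :: "(real \<Rightarrow> real) \<Rightarrow> nat \<Rightarrow> real \<Rightarrow> bool" where
  "regular_maximizer A m a \<longleftrightarrow>
     1 \<le> m \<and> a \<in> maximizers A \<and> 0 < a \<and> a < 1 \<and>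
     (\<forall>k. 1 \<le> k \<and> k \<le> 2 * m - 1 \<longrightarrow> (deriv ^^ k) A a = 0) \<and> (deriv ^^ (2 * m)) A a < 0"

text \<open>The supremum is taken in the extended nonnegative reals, so that it is always meaningful. The test
  functions are differentiable with \<open>\<bar>h'\<bar> \<le> 1\<close>; the lemma \<open>wasserstein_eq_lipschitz\<close> below shows
  that taking all 1-Lipschitz test functions gives the same distance.\<close>

definition wasserstein :: "real measure \<Rightarrow> real measure \<Rightarrow> ennreal" where
  "wasserstein P Q =
     (SUP h \<in> {h :: real \<Rightarrow> real. \<forall>x. h differentiable (at x) \<and> \<bar>deriv h x\<bar> \<le> 1}.
        ennreal \<bar>(\<integral>x. h x \<partial>P) - (\<integral>x. h x \<partial>Q)\<bar>)"

definition proportional_law :: "(real \<Rightarrow> real) \<Rightarrow> real measure" where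
  "proportional_law g = density lborel (\<lambda>x. ennreal (g x / (\<integral>y. g y \<partial>lborel)))"

text \<open>The second argument of \<open>normal_density\<close> is the standard deviation.\<close>

definition centered_normal :: "real \<Rightarrow> real measure" where
  "centered_normal v = density lborel (\<lambda>x. ennreal (normal_density 0 (sqrt v) x))"

lemma lipschitz_smoothing:
  fixes h :: "real \<Rightarrow> real"
  assumes h: "1-lipschitz_on UNIV h" and e: "0 < e"
  obtains g where "\<And>x. g differentiable (at x)" "\<And>x. \<bar>deriv g x\<bar> \<le> 1" "\<And>x. \<bar>g x - h x\<bar> \<le> e"
proof -
  have lip: "\<bar>h x - h y\<bar> \<le> \<bar>x - y\<bar>" for x y
    using lipschitz_onD[OF h, of x y] by (simp add: dist_real_def)
  have cont: "isCont h x" for x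
    using lipschitz_on_continuous_on[OF h] by (simp add: continuous_on_eq_continuous_at)
  define H where "H x = interval_lebesgue_integral lborel (ereal 0) (ereal x) h" for x
  have H: "(H has_real_derivative h x) (at x)" for x
  proof -
    define r where "r = \<bar>x\<bar> + 1"
    have "continuous_on {-r..r} h"
      using cont by (simp add: continuous_at_imp_continuous_on)
    then have "(H has_vector_derivative h x) (at x within {-r..r})"
      using interval_integral_FTC2[of "-r" 0 r h x] unfolding H_def[abs_def] by (simp add: r_def)
    moreover have "at x within {-r..r} = at x"
      by (rule at_within_interior) (auto simp: r_def)
    ultimately show ?thesis
      by (simp add: has_real_derivative_iff_has_vector_derivative)
  qed
  define g where "g x = (H (x + e) - H (x - e)) / (2 * e)" for x
  have g: "(g has_real_derivative (h (x + e) - h (x - e)) / (2 * e)) (at x)" for x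
  proof -
    have "((\<lambda>x. H (x + e) - H (x - e)) has_real_derivative h (x + e) * 1 - h (x - e) * 1) (at x)"
      by (intro DERIV_diff DERIV_chain2[OF H]) (auto intro!: derivative_eq_intros)
    then show ?thesis
      unfolding g_def[abs_def] using DERIV_cdivide[of _ _ x UNIV "2 * e"] by simp
  qed
  have 1: "g differentiable (at x)" for x
    using g real_differentiable_def by blast
  have 2: "\<bar>deriv g x\<bar> \<le> 1" for x
    using lip[of "x + e" "x - e"] e by (simp add: DERIV_imp_deriv[OF g])
  have 3: "\<bar>g x - h x\<bar> \<le> e" for x
  proof -
    obtain z where z: "x - e < z" "z < x + e" "H (x + e) - H (x - e) = (x + e - (x - e)) * h z"
      using MVT2[of "x - e" "x + e" H h] e H by auto
    then have "g x = h z" using e by (simp add: g_def)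
    with lip[of z x] z show ?thesis by auto
  qed
  show ?thesis using that 1 2 3 by blast
qed

lemma integrable_lipschitz:
  fixes h :: "real \<Rightarrow> real"
  assumes "prob_space P" "sets P = sets borel" "integrable P (\<lambda>x. x)" "1-lipschitz_on UNIV h"
  shows "integrable P h"
proof -
  interpret prob_space P by fact
  have "\<bar>h x\<bar> \<le> \<bar>h 0\<bar> + \<bar>x\<bar>" for x
    using lipschitz_onD[OF assms(4), of x 0] by (simp add: dist_real_def)
  moreover have "h \<in> borel_measurable P"
    using borel_measurable_continuous_onI[OF lipschitz_on_continuous_on[OF assms(4)]]
    unfolding measurable_cong_sets[OF assms(2) refl] .
  moreover have "integrable P (\<lambda>x. \<bar>h 0\<bar> + \<bar>x\<bar>)"
    using assms(3) by simp
  ultimately show ?thesis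
    by (elim Bochner_Integration.integrable_bound) simp_all
qed

lemma wasserstein_eq_lipschitz:
  assumes P: "prob_space P" "sets P = sets borel" "integrable P (\<lambda>x. x)"
    and Q: "prob_space Q" "sets Q = sets borel" "integrable Q (\<lambda>x. x)"
  shows "wasserstein P Q =
    (SUP h \<in> {h :: real \<Rightarrow> real. 1-lipschitz_on UNIV h}. ennreal \<bar>(\<integral>x. h x \<partial>P) - (\<integral>x. h x \<partial>Q)\<bar>)"
    (is "_ = ?R")
proof (rule antisym)
  have D: "1-lipschitz_on UNIV h"
    if "\<forall>x. h differentiable (at x) \<and> \<bar>deriv h x\<bar> \<le> 1" for h :: "real \<Rightarrow> real"
  proof (rule lipschitz_onI)
    fix x y
    have "(h has_real_derivative deriv h z) (at z within UNIV)" for z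
      using that DERIV_deriv_iff_real_differentiable by simp
    then have "norm (h x - h y) \<le> 1 * norm (x - y)"
      using that by (intro field_differentiable_bound[of UNIV h "deriv h"]) auto
    then show "dist (h x) (h y) \<le> 1 * dist x y" by (simp add: dist_norm)
  qed simp
  then show "wasserstein P Q \<le> ?R"
    unfolding wasserstein_def by (intro SUP_subset_mono) auto
  show "?R \<le> wasserstein P Q"
  proof (rule SUP_least, rule ennreal_le_epsilon)
    fix h :: "real \<Rightarrow> real" and e :: real
    assume h: "h \<in> {h. 1-lipschitz_on UNIV h}" and e: "0 < e"
    obtain g where g: "\<And>x. g differentiable (at x)" "\<And>x. \<bar>deriv g x\<bar> \<le> 1"
      "\<And>x. \<bar>g x - h x\<bar> \<le> e / 2"
      using lipschitz_smoothing[of h "e / 2"] h e by auto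
    have *: "\<bar>(\<integral>x. g x \<partial>M) - (\<integral>x. h x \<partial>M)\<bar> \<le> e / 2"
      if M: "prob_space M" "sets M = sets borel" "integrable M (\<lambda>x. x)" for M
    proof -
      interpret prob_space M by fact
      have i: "integrable M g" "integrable M h"
        using integrable_lipschitz[OF M] D[of g] g h by auto
      then have "\<bar>(\<integral>x. g x \<partial>M) - (\<integral>x. h x \<partial>M)\<bar> = \<bar>\<integral>x. g x - h x \<partial>M\<bar>" by simp
      also have "\<dots> \<le> (\<integral>x. \<bar>g x - h x\<bar> \<partial>M)" by (rule integral_abs_bound)
      also have "\<dots> \<le> (\<integral>x. e / 2 \<partial>M)" using i g(3) by (intro integral_mono) auto
      finally show ?thesis by (simp add: prob_space)
    qed
    have "ennreal \<bar>(\<integral>x. h x \<partial>P) - (\<integral>x. h x \<partial>Q)\<bar>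
        \<le> ennreal (\<bar>(\<integral>x. g x \<partial>P) - (\<integral>x. g x \<partial>Q)\<bar> + e)"
      using *[OF P] *[OF Q] by (intro ennreal_leI) linarith
    also have "\<dots> = ennreal \<bar>(\<integral>x. g x \<partial>P) - (\<integral>x. g x \<partial>Q)\<bar> + ennreal e"
      using e by simp
    also have "\<dots> \<le> wasserstein P Q + ennreal e"
      unfolding wasserstein_def using g by (intro add_right_mono SUP_upper) auto
    finally show "ennreal \<bar>(\<integral>x. h x \<partial>P) - (\<integral>x. h x \<partial>Q)\<bar> \<le> wasserstein P Q + ennreal e" .
  qed
qed

end

theory Submission
  imports Defs
begin

text \<open>
  Only the number \<open>k\<close> of plus spins matters; it has weight \<open>(n choose k) exp (n f (k / n))\<close>. By Stirling's
  formula this is, up to a factor that does not depend on \<open>k\<close> and a relative error of the order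
  \<open>\<bar>k / n - a\<bar> + 1 / n\<close>, equal to \<open>exp (n (A (k / n) - A a))\<close>. At a \<open>2m\<close>-regular maximizer \<open>a\<close> the scale
  \<open>r = n powr (- 1 / (2m))\<close> turns the exponent into \<open>- c (y / 2) ^ (2m)\<close> with \<open>y = 2 (k / n - a) / r\<close>, up to an
  error \<open>O(r)\<close>. The nodes \<open>y\<close> have spacing \<open>O(r)\<close>, so conditional expectations of Lipschitz functions are
  quotients of Riemann sums that differ from the corresponding integrals by \<open>O(r)\<close>. The total
  mass near \<open>a\<close> is of the order \<open>exp (n A(a)) n powr (1/2 - 1 / (2m))\<close>; hence the flatter of two maximizers
  wins, which is the law of large numbers.

  For the shape of \<open>A\<close>, put \<open>t = 2a - 1\<close> and \<open>G(t) = A(a) - ln 2\<close>. The parameters are such that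
  \<open>G\<close> and \<open>G'\<close> vanish at \<open>0\<close> and at \<open>9/10\<close>. On \<open>(0, 1)\<close> the sign of \<open>G''\<close> is that of a polynomial
  with sign pattern \<open>-, +, -\<close>, which forces \<open>G < 0\<close> elsewhere; negative \<open>t\<close> follow from \<open>h > 0\<close>.
\<close>

section \<open>Stirling's formula up to a constant, and Riemann sums\<close>

text \<open>The estimates must hold uniformly over unbounded test functions, while the nodes fill an
  interval whose length grows with \<open>n\<close>. Therefore every error is brought into the form
  \<open>O(r) / (1 + y\<^sup>2)\<close>, which integrates to \<open>O(r)\<close> over the whole
  line; the decay of the limit density pays for the polynomial factors that this costs. Test
  functions may be shifted by a constant, because both laws have mass one; this turns a Lipschitz
  bound into linear growth. Factors common to all weights cancel in conditional means, and between
  the two maximizers only the power of \<open>n\<close> is compared.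

  The model is designed from \<open>E(t) = - t^2/2 - t^4/12 - ...\<close>: its quadratic term
  cancels the first summand, so \<open>G\<close> is of fourth order at \<open>0\<close>, with fourth
  derivative \<open>-2\<close> in \<open>t\<close>, that is \<open>-32\<close> in \<open>a\<close>.
  The two remaining coefficients are then just enough to make \<open>G\<close> touch the level
  \<open>0\<close> a second time, at \<open>9/10\<close>.\<close>

definition ln_fact_remainder :: "nat \<Rightarrow> real" where
  "ln_fact_remainder n = ln (fact n) - (real n * ln (real n) - real n + ln (real n) / 2)"

text \<open>The difference of consecutive remainders contains \<open>ln (n + 1) - ln n\<close>, the
  integral of the convex function \<open>1 / x\<close> over a unit interval. The midpoint rule
  bounds it from below, the trapezoidal rule from above.\<close>

lemma ln_fact_remainder_Suc:
  assumes "1 \<le> n"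
  shows "ln_fact_remainder (Suc n) \<le> ln_fact_remainder n"
    and "ln_fact_remainder n - 1 / (4 * real n)
      \<le> ln_fact_remainder (Suc n) - 1 / (4 * real (Suc n))"
proof -
  have n: "0 < real n" using assms by simp
  have "ln (fact (Suc n) :: real) = ln (real n + 1) + ln (fact n)"
    using n by (simp add: ln_mult distrib_right[symmetric] add.commute)
  then have diff: "ln_fact_remainder n - ln_fact_remainder (Suc n)
      = (real n + 1 / 2) * (ln (real n + 1) - ln (real n)) - 1"
    unfolding ln_fact_remainder_def by (simp add: algebra_simps del: fact_Suc)
  have "1 = (real n + 1 / 2) * (2 * ((real n + 1) - real n) / (real n + (real n + 1)))"
    using n by (simp add: field_simps)
  also have "\<dots> \<le> (real n + 1 / 2) * (ln (real n + 1) - ln (real n))"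
    using n by (intro mult_left_mono ln_inverse_approx_ge) auto
  finally show "ln_fact_remainder (Suc n) \<le> ln_fact_remainder n"
    using diff by linarith
  have "(real n + 1 / 2) * (ln (real n + 1) - ln (real n))
      \<le> (real n + 1 / 2) * (1 * (inverse (real n) + inverse (real n + 1)) / 2)"
    using n ln_inverse_approx_le[of "real n" 1] by (intro mult_left_mono) auto
  \<comment> \<open>The excess over \<open>1\<close> is \<open>1 / (4 * n * (n + 1))\<close>,
    written as a telescoping difference.\<close>
  also have "\<dots> = 1 + (1 / (4 * real n) - 1 / (4 * real (Suc n)))"
    using n by (simp add: divide_simps) (simp add: algebra_simps)
  finally show "ln_fact_remainder n - 1 / (4 * real n)
      \<le> ln_fact_remainder (Suc n) - 1 / (4 * real (Suc n))"
    using diff by linarith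
qed

text \<open>A decreasing and an increasing sequence with gap \<open>1 / (4 * n)\<close> enclose one
  limit. Its value cancels later from all quotients of weights.\<close>

lemma stirling_up_to_constant:
  obtains L where "\<And>n. 1 \<le> n \<Longrightarrow> \<bar>ln_fact_remainder n - L\<bar> \<le> 1 / (4 * real n)"
proof -
  \<comment> \<open>The index is shifted because the estimates start at
    \<open>n = 1\<close>.\<close>
  define u where "u n = ln_fact_remainder (Suc n)" for n
  define l where "l n = ln_fact_remainder (Suc n) - 1 / (4 * real (Suc n))" for n
  have ul: "decseq u" "incseq l"
    unfolding u_def l_def using ln_fact_remainder_Suc
    by (auto intro!: decseq_SucI incseq_SucI simp del: of_nat_Suc)
  have lu: "l n \<le> u n" for n by (simp add: u_def l_def)
  have le: "l n \<le> u m" for n m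
    using incseqD[OF ul(2), of n "max n m"] lu[of "max n m"] decseqD[OF ul(1), of m "max n m"]
    by simp
  define L where "L = (SUP n. l n)"
  have bdd: "bdd_above (range l)" using le[of _ 0] by (intro bdd_aboveI[of _ "u 0"]) auto
  have "l n \<le> L" for n unfolding L_def using bdd by (simp add: cSUP_upper)
  moreover have "L \<le> u n" for n unfolding L_def using le by (intro cSUP_least) auto
  ultimately have "\<bar>ln_fact_remainder (Suc n) - L\<bar> \<le> 1 / (4 * real (Suc n))" for n
    by (smt (verit) l_def u_def)
  then show ?thesis using that[of L] by (metis Suc_le_D One_nat_def)
qed

text \<open>Of Stirling's terms for the three factorials, those of the form \<open>x * ln x\<close>
  assemble to the entropy and those of the form \<open>ln x / 2\<close> to the prefactor; the linear
  ones cancel.\<close>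

lemma ln_binomial:
  assumes "1 \<le> k" "k < n"
  shows "ln (real (n choose k)) = real n * entropy_I (real k / real n)
    - ln (real n) / 2 - ln (real k / real n * (1 - real k / real n)) / 2
    + (ln_fact_remainder n - ln_fact_remainder k - ln_fact_remainder (n - k))"
proof -
  have n: "0 < real n" "0 < real k" "0 < real (n - k)" "1 - real k / real n = real (n - k) / real n"
    using assms by (auto simp: field_simps of_nat_diff)
  have k': "real (n - k) = real n - real k" using assms by simp
  have "ln (real (n choose k)) = ln (fact n) - ln (fact k) - ln (fact (n - k))"
    using assms by (simp add: binomial_fact ln_div ln_mult)
  also have "real n * entropy_I (real k / real n)
      = real n * ln n - real k * ln k - real (n - k) * ln (real (n - k))"
    unfolding entropy_I_def n(4) using n by (simp add: ln_div field_simps k')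
  moreover have "ln (real k / real n * (1 - real k / real n))
      = ln k + ln (real (n - k)) - 2 * ln n"
    unfolding n(4) using n by (simp add: ln_div ln_mult)
  ultimately show ?thesis
    by (simp add: ln_fact_remainder_def k' field_simps)
qed

text \<open>With success probability \<open>k / n\<close>, exactly \<open>k\<close> successes have
  probability \<open>(n choose k) * exp (- n * I)\<close>, which is at most one. In contrast to
  Stirling's formula this covers \<open>k = 0\<close> and \<open>k = n\<close>.\<close>

lemma binomial_le_exp_entropy:
  assumes "k \<le> n" "1 \<le> n"
  shows "real (n choose k) \<le> exp (real n * entropy_I (real k / real n))"
proof -
  define a where "a = real k / real n"
  have a: "0 \<le> a" "a \<le> 1" using assms by (auto simp: a_def field_simps)
  \<comment> \<open>At \<open>k = 0\<close> or \<open>k = n\<close> a base vanishes together with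
    its exponent, so \<open>0 ^ 0 = 1\<close> agrees with \<open>exp (0 * ln 0)\<close>.\<close>
  have pow: "x ^ j = exp (real j * ln x)" if "0 \<le> x" "x = 0 \<Longrightarrow> j = 0" for x :: real and j
    using that by (cases "x = 0") (auto simp: exp_of_nat_mult)
  have n1: "real n * a = real k" "real n * (1 - a) = real (n - k)"
    using assms by (auto simp: a_def field_simps of_nat_diff)
  have "real (n choose k) * a ^ k * (1 - a) ^ (n - k)
      \<le> (\<Sum>j\<le>n. real (n choose j) * a ^ j * (1 - a) ^ (n - j))"
    using assms a by (intro member_le_sum) auto
  also have "\<dots> = 1" using binomial_ring[of a "1 - a" n] by simp
  also have "real (n choose k) * a ^ k * (1 - a) ^ (n - k)
      = real (n choose k) * exp (- (real n * entropy_I a))"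
  proof -
    have "a ^ k = exp (real k * ln a)"
      using a n1 assms by (intro pow) auto
    moreover have "(1 - a) ^ (n - k) = exp (real (n - k) * ln (1 - a))"
      using a n1 assms by (intro pow) auto
    moreover have "- (real n * entropy_I a) = real k * ln a + real (n - k) * ln (1 - a)"
      unfolding entropy_I_def n1[symmetric] by (simp add: algebra_simps)
    ultimately show ?thesis by (simp add: exp_add)
  qed
  finally show ?thesis by (simp add: exp_minus field_simps a_def)
qed

section \<open>Riemann sums with errors weighted by the Cauchy kernel\<close>

lemma integrable_cauchy_kernel:
  shows "integrable lborel (\<lambda>x::real. 1 / (1 + x\<^sup>2))"
    and "(\<integral>x. 1 / (1 + x\<^sup>2) \<partial>lborel) = pi"
  using integrable_inverse_1_plus_square LBINT_inverse_1_plus_square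
  by (simp_all add: set_integrable_def interval_lebesgue_integral_def 
      set_lebesgue_integral_def inverse_eq_divide)

text \<open>The sum is the integral of a step function on disjoint cells of length \<open>s\<close>.
  Its pointwise distance to \<open>\<Phi>\<close> is at most \<open>e\<close> times the Cauchy
  kernel both on the cells and off them, where the step function is zero; the kernel has integral
  \<open>pi\<close>.\<close>

lemma riemann_sum_bound:
  fixes F :: "nat \<Rightarrow> real" and \<Phi> :: "real \<Rightarrow> real"
  assumes K: "finite K" and s: "0 < s"
    and \<Phi>: "integrable lborel \<Phi>"
    and cell: "\<And>k y. k \<in> K \<Longrightarrow> b + s * real k \<le> y \<Longrightarrow> y < b + s * real k + s
      \<Longrightarrow> \<bar>F k - \<Phi> y\<bar> \<le> e / (1 + y\<^sup>2)"
    and off: "\<And>y. (\<And>k. k \<in> K \<Longrightarrow> y \<notin> {b + s * real k..<b + s * real k + s})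
      \<Longrightarrow> \<bar>\<Phi> y\<bar> \<le> e / (1 + y\<^sup>2)"
  shows "\<bar>s * (\<Sum>k\<in>K. F k) - (\<integral>y. \<Phi> y \<partial>lborel)\<bar> \<le> e * pi"
proof -
  define I where "I k = {b + s * real k..<b + s * real k + s}" for k
  define G where "G y = (\<Sum>k\<in>K. indicator (I k) y * F k)" for y
  have uniq: "j = k" if "y \<in> I j" "y \<in> I k" for j k y
  proof -
    have "s * real j < s * (real k + 1)" "s * real k < s * (real j + 1)"
      using that by (auto simp: I_def algebra_simps)
    then have "real j < real k + 1" "real k < real j + 1" using s by (simp_all add: mult_less_cancel_left_pos)
    then show ?thesis by linarith
  qed
  have Gi: "integrable lborel G"
    unfolding G_def I_def by (intro Bochner_Integration.integrable_sum integrable_mult_left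
        integrable_real_indicator) (auto simp: less_imp_le[OF s])
  have "(\<integral>y. G y \<partial>lborel) = (\<Sum>k\<in>K. s * F k)"
    unfolding G_def I_def
    by (subst Bochner_Integration.integral_sum)
      (auto intro!: integrable_mult_left integrable_real_indicator simp: less_imp_le[OF s])
  then have "\<bar>s * (\<Sum>k\<in>K. F k) - (\<integral>y. \<Phi> y \<partial>lborel)\<bar> = \<bar>\<integral>y. G y - \<Phi> y \<partial>lborel\<bar>"
    using Gi \<Phi> by (simp add: sum_distrib_left)
  also have "\<dots> \<le> (\<integral>y. \<bar>G y - \<Phi> y\<bar> \<partial>lborel)" by (rule integral_abs_bound)
  also have "\<dots> \<le> (\<integral>y. e * (1 / (1 + y\<^sup>2)) \<partial>lborel)"
  proof (rule integral_mono)
    show "integrable lborel (\<lambda>y. \<bar>G y - \<Phi> y\<bar>)" using Gi \<Phi> by simp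
    show "integrable lborel (\<lambda>y. e * (1 / (1 + y\<^sup>2)))"
      by (intro integrable_mult_right integrable_cauchy_kernel)
    show "\<bar>G y - \<Phi> y\<bar> \<le> e * (1 / (1 + y\<^sup>2))" for y
    proof (cases "\<exists>k\<in>K. y \<in> I k")
      case True
      then obtain k where k: "k \<in> K" "y \<in> I k" by auto
      have "G y = (\<Sum>j\<in>K. if j = k then F k else 0)"
        unfolding G_def using k uniq by (intro sum.cong) (auto simp: indicator_def)
      then have "G y = F k" using K k by simp
      then show ?thesis using cell[of k y] k by (simp add: I_def)
    next
      case False
      then have "G y = 0" unfolding G_def by (intro sum.neutral) auto
      then show ?thesis using off[of y] False by (simp add: I_def)
    qed
  qed
  also have "\<dots> = e * pi" by (simp only: integral_mult_right_zero integrable_cauchy_kernel(2))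
  finally show ?thesis .
qed

section \<open>Local Laplace asymptotics\<close>

definition spin_weight :: "(real \<Rightarrow> real) \<Rightarrow> nat \<Rightarrow> nat \<Rightarrow> real" where
  "spin_weight f n k = real (n choose k) * exp (real n * f (real k / real n))"

text \<open>The argument is halved because the magnetization is \<open>2 * k - n\<close>: its
  rescaled deviation is twice that of the number of plus spins.\<close>

definition quasi_gaussian :: "real \<Rightarrow> nat \<Rightarrow> real \<Rightarrow> real" where
  "quasi_gaussian c m x = exp (- c * (x / 2) ^ (2 * m))"

text \<open>The class contains the constant \<open>1\<close>, which yields the normalization, and
  \<open>h - h 0\<close> for every 1-Lipschitz \<open>h\<close>.\<close>

definition linear_test :: "(real \<Rightarrow> real) \<Rightarrow> bool" where
  "linear_test h \<longleftrightarrow> (\<forall>x. \<bar>h x\<bar> \<le> 1 + \<bar>x\<bar>) \<and> (\<forall>x y. \<bar>h x - h y\<bar> \<le> \<bar>x - y\<bar>)"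

lemma quasi_gaussian_pos [simp]: "0 < quasi_gaussian c m x"
  by (simp add: quasi_gaussian_def)

text \<open>Bernoulli's inequality gives \<open>z ^ (2 * m) >= z ^ 2 - 1\<close> for
  \<open>z = |x| / 2\<close>, which reduces the claim to the Gaussian case. There
  \<open>1 + |x| <= exp |x|\<close> and completing the square suffice.\<close>

lemma quasi_gaussian_moment_bound:
  assumes c: "0 < c" and m: "1 \<le> m"
  obtains B where "0 < B" "\<And>x. (1 + \<bar>x\<bar>) ^ p * quasi_gaussian c m x \<le> B"
proof -
  have "(1 + \<bar>x\<bar>) ^ p * quasi_gaussian c m x \<le> exp (real p ^ 2 / c + c)" for x
  proof -
    define z where "z = \<bar>x\<bar> / 2"
    have z: "0 \<le> z" "\<bar>x\<bar> = 2 * z" by (auto simp: z_def)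
    have "1 + real m * (z\<^sup>2 - 1) \<le> (1 + (z\<^sup>2 - 1)) ^ m"
      by (rule Bernoulli_inequality) simp
    then have b: "1 + real m * (z\<^sup>2 - 1) \<le> z ^ (2 * m)" by (simp add: power_mult)
    have zm: "z\<^sup>2 - 1 \<le> z ^ (2 * m)"
    proof (cases "1 \<le> z\<^sup>2")
      case True
      then have "1 * (z\<^sup>2 - 1) \<le> real m * (z\<^sup>2 - 1)" using m by (intro mult_right_mono) auto
      also have "\<dots> \<le> z ^ (2 * m)" using b by (rule order_trans[rotated]) simp
      finally show ?thesis by simp
    next
      case False
      have "0 \<le> z ^ (2 * m)" using z by simp
      then show ?thesis using False by linarith
    qed
    have "(1 + \<bar>x\<bar>) ^ p \<le> exp \<bar>x\<bar> ^ p"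
      by (intro power_mono) (auto simp: exp_ge_add_one_self)
    also have "\<dots> = exp (2 * real p * z)" by (simp add: z exp_of_nat_mult[symmetric] mult_ac)
    finally have 1: "(1 + \<bar>x\<bar>) ^ p \<le> exp (2 * real p * z)" .
    have "quasi_gaussian c m x = exp (- c * z ^ (2 * m))"
      by (simp add: quasi_gaussian_def z_def power_mult power_divide)
    also have "\<dots> \<le> exp (- c * (z\<^sup>2 - 1))" using zm c by simp
    finally have 2: "quasi_gaussian c m x \<le> exp (- c * (z\<^sup>2 - 1))" .
    \<comment> \<open>This yields \<open>2 * p * z <= p ^ 2 / c + c * z ^ 2\<close>, so the
      quadratic terms cancel in the total exponent.\<close>
    have "0 \<le> (real p - c * z)\<^sup>2" by simp
    then have "2 * real p * z * c \<le> real p ^ 2 + c\<^sup>2 * z\<^sup>2"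
      by (simp add: power2_eq_square algebra_simps)
    then have "2 * real p * z \<le> (real p ^ 2 + c\<^sup>2 * z\<^sup>2) / c"
      using c by (simp only: pos_le_divide_eq)
    also have "\<dots> = real p ^ 2 / c + c * z\<^sup>2"
      using c by (simp add: add_divide_distrib power2_eq_square)
    finally have 3: "2 * real p * z + - c * (z\<^sup>2 - 1) \<le> real p ^ 2 / c + c"
      by (simp add: algebra_simps)
    have "(1 + \<bar>x\<bar>) ^ p * quasi_gaussian c m x \<le> exp (2 * real p * z) * exp (- c * (z\<^sup>2 - 1))"
      using 1 2 by (intro mult_mono) (auto simp: less_imp_le)
    also have "\<dots> \<le> exp (real p ^ 2 / c + c)"
      using 3 by (simp only: exp_add[symmetric] exp_le_cancel_iff)
    finally show ?thesis .
  qed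
  then show ?thesis using that[of "exp (real p ^ 2 / c + c)"] by simp
qed

lemma abs_exp_diff_le:
  fixes u v w :: real
  assumes "u \<le> w" "v \<le> w"
  shows "\<bar>exp u - exp v\<bar> \<le> \<bar>u - v\<bar> * exp w"
proof -
  have *: "exp y - exp x \<le> (y - x) * exp w" if "x \<le> y" "y \<le> w" for x y :: real
  proof -
    have "exp y - exp x = exp y * (1 - exp (x - y))" by (simp add: right_diff_distrib exp_add[symmetric])
    also have "\<dots> \<le> exp y * (y - x)"
      using exp_ge_add_one_self[of "x - y"] by (intro mult_left_mono) (simp_all del: exp_ge_add_one_self)
    also have "\<dots> \<le> exp w * (y - x)" using that by (intro mult_right_mono) auto
    finally show ?thesis by (simp add: mult.commute)
  qed
  show ?thesis
    using *[of u v] *[of v u] assms by (cases "u \<le> v") auto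
qed

lemma abs_ln_diff_le:
  fixes x y c :: real
  assumes "0 < c" "c \<le> x" "c \<le> y"
  shows "\<bar>ln x - ln y\<bar> \<le> \<bar>x - y\<bar> / c"
proof -
  have *: "ln x - ln y \<le> \<bar>x - y\<bar> / c" if "c \<le> x" "c \<le> y" for x y :: real
  proof -
    have "ln x - ln y \<le> (x - y) / y" using that assms(1) by (intro ln_diff_le) auto
    also have "\<dots> \<le> \<bar>x - y\<bar> / c" using that assms(1) by (intro frac_le) auto
    finally show ?thesis .
  qed
  show ?thesis using *[of x y] *[of y x] assms by (simp add: abs_le_iff abs_minus_commute)
qed

text \<open>The bound on \<open>K * d\<close> lets half of the leading term absorb the Taylor remainder on the whole window.\<close>

locale laplace_point =
  fixes f :: "real \<Rightarrow> real" and a c K d :: real and m :: nat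
  assumes m: "1 \<le> m" and d: "0 < d" "d < a" "d < 1 - a" and c: "0 < c" and K: "0 \<le> K"
    and Kd: "K * d \<le> c / 2"
    and taylor: "\<And>x. \<bar>x - a\<bar> \<le> d \<Longrightarrow>
      \<bar>(f x + entropy_I x) - (f a + entropy_I a) + c * (x - a) ^ (2 * m)\<bar> \<le> K * \<bar>x - a\<bar> ^ (2 * m + 1)"
begin

text \<open>The solution \<open>r\<close> of \<open>n * r ^ (2 * m) = 1\<close>, which removes
  \<open>n\<close> from the leading exponent.\<close>

definition scale :: "nat \<Rightarrow> real" where
  "scale n = real n powr (- 1 / (2 * real m))"

text \<open>The distance between the nodes of \<open>k\<close> and \<open>k + 1\<close>.\<close>

definition mesh :: "nat \<Rightarrow> real" where
  "mesh n = 2 / (real n * scale n)"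

definition node :: "nat \<Rightarrow> nat \<Rightarrow> real" where
  "node n k = 2 * (real k / real n - a) / scale n"

definition window :: "nat \<Rightarrow> nat set" where
  "window n = {k. k \<le> n \<and> \<bar>real k / real n - a\<bar> < d}"

lemma finite_window [simp]: "finite (window n)"
  by (rule finite_subset[of _ "{..n}"]) (auto simp: window_def)

lemma scale:
  assumes "1 \<le> n"
  shows "0 < scale n" "scale n \<le> 1" "real n * scale n ^ (2 * m) = 1"
proof -
  have n: "1 \<le> real n" using assms by simp
  show "0 < scale n" using n by (simp add: scale_def)
  have "real n powr (- 1 / (2 * real m)) \<le> real n powr 0"
    using n m by (intro powr_mono) auto
  then show "scale n \<le> 1" using n by (simp add: scale_def)
  have "scale n ^ (2 * m) = real n powr (real (2 * m) * (- 1 / (2 * real m)))"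
    using n by (simp add: scale_def powr_realpow[symmetric] powr_powr mult.commute)
  also have "real (2 * m) * (- 1 / (2 * real m)) = - 1" using m by simp
  finally show "real n * scale n ^ (2 * m) = 1" using n by (simp add: powr_minus)
qed

text \<open>This absorbs Stirling's error \<open>O(1 / n)\<close> into the rate:
  \<open>1 / n\<close> is the power \<open>2 * m\<close> of a number in
  \<open>(0, 1]\<close>.\<close>

lemma inverse_le_scale:
  assumes "1 \<le> n"
  shows "1 / real n \<le> scale n"
proof -
  have "1 / real n = scale n ^ (2 * m)" using scale[OF assms] assms by (simp add: field_simps)
  also have "\<dots> \<le> scale n ^ 1" using scale[OF assms] m by (intro power_decreasing) auto
  finally show ?thesis by simp
qed

text \<open>The mesh equals \<open>2 * r ^ (2 * m - 1)\<close> with \<open>r = scale n\<close>, so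
  discretization costs no more than the rate \<open>r\<close>; for \<open>m = 1\<close> it costs
  exactly that order.\<close>

lemma mesh:
  assumes "1 \<le> n"
  shows "0 < mesh n" "mesh n \<le> 2 * scale n" "mesh n \<le> 2"
proof -
  have n: "0 < real n" using assms by simp
  note r = scale[OF assms]
  show "0 < mesh n" using n r by (simp add: mesh_def)
  have "scale n ^ (2 * m) \<le> scale n ^ 2" using r m by (intro power_decreasing) auto
  then have "1 \<le> real n * scale n ^ 2" using r(3) n by (metis mult_left_mono less_imp_le)
  then have "2 / (real n * scale n) \<le> 2 * scale n"
    using n r by (simp add: power2_eq_square field_simps)
  then show "mesh n \<le> 2 * scale n" by (simp add: mesh_def)
  then show "mesh n \<le> 2" using r by linarith
qed

lemma node_eq: "node n k = - 2 * a / scale n + mesh n * real k"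
  by (simp add: node_def mesh_def diff_divide_distrib right_diff_distrib)

lemma scale_tendsto_0: "scale \<longlonglongrightarrow> 0"
  unfolding scale_def using m
  by (intro tendsto_neg_powr filterlim_real_sequentially) auto

text \<open>The logarithm \<open>u\<close> of the normalized weight is compared with
  \<open>v = - c * (y / 2) ^ (2 * m)\<close>. Their difference is \<open>n\<close> times the Taylor
  remainder plus the errors of Stirling's formula and of the prefactor. Passing to exponentials
  keeps only the decay rate \<open>c / 2\<close>, since half of the exponent controls the Taylor
  remainder far from \<open>a\<close>.\<close>

lemma spin_weight_asymp:
  obtains B L where "0 \<le> B"
    "\<forall>n\<ge>1. \<forall>k\<in>window n.
      \<bar>spin_weight f n k / exp (real n * (f a + entropy_I a) - ln (real n) / 2 - L)
        - quasi_gaussian c m (node n k)\<bar>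
      \<le> B * scale n * (1 + \<bar>node n k\<bar>) ^ (2 * m + 1) * quasi_gaussian (c / 2) m (node n k)"
proof -
  obtain L0 where L0: "\<And>n. 1 \<le> n \<Longrightarrow> \<bar>ln_fact_remainder n - L0\<bar> \<le> 1 / (4 * real n)"
    using stirling_up_to_constant by blast
  \<comment> \<open>A lower bound for \<open>p\<close> and \<open>1 - p\<close> throughout the
    window, so logarithms and Stirling errors are under uniform control.\<close>
  define q where "q = min (a - d) (1 - a - d)"
  have q: "0 < q" "q \<le> a - d" "q \<le> 1 - a - d" "q \<le> 1/2" using d by (auto simp: q_def min_def)
  \<comment> \<open>The remainders contribute \<open>L0 - L0 - L0 = - L0\<close>, and the prefactor
    is frozen at \<open>a\<close>.\<close>
  define L where "L = L0 + ln (a * (1 - a)) / 2"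
  define B where "B = (K + 2 / q) * exp (2 / q)"
  have "0 \<le> B" using q K by (simp add: B_def)
  moreover have "\<bar>spin_weight f n k / exp (real n * (f a + entropy_I a) - ln (real n) / 2 - L)
        - quasi_gaussian c m (node n k)\<bar>
      \<le> B * scale n * (1 + \<bar>node n k\<bar>) ^ (2 * m + 1) * quasi_gaussian (c / 2) m (node n k)"
    if n1: "1 \<le> n" and k: "k \<in> window n" for n k
  proof -
    define p where "p = real k / real n"
    define r where "r = scale n"
    define y where "y = node n k"
    define u where "u = ln (spin_weight f n k) - (real n * (f a + entropy_I a) - ln (real n) / 2 - L)"
    define v where "v = - c * (y / 2) ^ (2 * m)"
    have n: "0 < real n" "1 \<le> real n" using n1 by auto
    have r: "0 < r" "r \<le> 1" "real n * r ^ (2 * m) = 1" "1 / real n \<le> r"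
      using scale[OF n1] inverse_le_scale[OF n1] by (auto simp: r_def)
    have pd: "\<bar>p - a\<bar> < d" using k by (simp add: window_def p_def)
    have p: "q \<le> p" "q \<le> 1 - p" "0 < p" "p < 1" using pd q by (auto simp: abs_less_iff)
    have kn: "real k = real n * p" using n by (simp add: p_def)
    have "0 < real k" unfolding kn using n p by simp
    moreover have "real k < real n * 1" unfolding kn using n p by (intro mult_strict_left_mono) auto
    ultimately have k': "1 \<le> k" "k < n" by simp_all
    have nk: "real (n - k) = real n * (1 - p)" using k' kn by (simp add: algebra_simps)
    have pa: "p - a = y / 2 * r" using r by (simp add: y_def node_def p_def r_def[symmetric])
    define R where "R = ln_fact_remainder n - ln_fact_remainder k - ln_fact_remainder (n - k)"
    have "\<bar>R + L0\<bar> \<le> 1 / (4 * real n) + 1 / (4 * real k) + 1 / (4 * real (n - k))"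
      unfolding R_def using L0[OF n1] L0[OF k'(1)] L0[of "n - k"] k' by linarith
    also have "\<dots> \<le> 1 / (4 * (real n * q)) + 1 / (4 * (real n * q)) + 1 / (4 * (real n * q))"
      unfolding kn nk using p q n by (intro add_mono frac_le mult_left_mono mult_pos_pos) auto
    also have "\<dots> \<le> 1 / q * (1 / real n)" using q n by (simp add: field_simps)
    finally have R: "\<bar>R + L0\<bar> \<le> 1 / q * (1 / real n)" .
    have "ln (p * (1 - p)) - ln (a * (1 - a)) = (ln p - ln a) + (ln (1 - p) - ln (1 - a))"
      using p d by (simp add: ln_mult)
    also have "\<bar>\<dots>\<bar> \<le> \<bar>p - a\<bar> / q + \<bar>(1 - p) - (1 - a)\<bar> / q"
      using p q d abs_ln_diff_le[of q p a] abs_ln_diff_le[of q "1 - p" "1 - a"] by linarith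
    also have "\<dots> = 2 * (1 / q * \<bar>p - a\<bar>)" by (simp add: abs_minus_commute)
    finally have G: "\<bar>ln (p * (1 - p)) - ln (a * (1 - a))\<bar> \<le> 2 * (1 / q * \<bar>p - a\<bar>)" .
    have pos: "0 < spin_weight f n k" using k' by (simp add: spin_weight_def zero_less_binomial)
    have "ln (spin_weight f n k) = ln (real (n choose k)) + real n * f p"
      using k' by (simp add: spin_weight_def ln_mult zero_less_binomial p_def)
    moreover define g1 where "g1 = ln (p * (1 - p))"
    moreover define g2 where "g2 = ln (a * (1 - a))"
    ultimately have u_eq: "u = real n * ((f p + entropy_I p) - (f a + entropy_I a))
        + ((R + L0) - (ln (p * (1 - p)) - ln (a * (1 - a))) / 2)"
      using ln_binomial[OF k'] unfolding u_def L_def R_def p_def[symmetric] g1_def[symmetric] g2_def[symmetric]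
      by (simp only: right_diff_distrib distrib_left) (simp add: field_simps)
    have E: "\<bar>(R + L0) - (ln (p * (1 - p)) - ln (a * (1 - a))) / 2\<bar> \<le> 1 / q * (1 / real n + \<bar>p - a\<bar>)"
    proof -
      have "\<bar>x - g / 2\<bar> \<le> X + Y" if "\<bar>x\<bar> \<le> X" "\<bar>g\<bar> \<le> 2 * Y" for x g X Y :: real
        using that by linarith
      from this[OF R G] show ?thesis by (simp only: distrib_left)
    qed
    have v_eq: "v = real n * (- c * (p - a) ^ (2 * m))"
      unfolding v_def pa power_mult_distrib using r(3) by (simp add: mult_ac)
    define T where "T = (f p + entropy_I p) - (f a + entropy_I a) + c * (p - a) ^ (2 * m)"
    have T: "\<bar>T\<bar> \<le> K * \<bar>p - a\<bar> ^ (2 * m + 1)" unfolding T_def using taylor[of p] pd by simp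
    have uv: "u - v = real n * T + ((R + L0) - (ln (p * (1 - p)) - ln (a * (1 - a))) / 2)"
      unfolding u_eq v_eq T_def by (simp add: algebra_simps)
    have nT: "\<bar>real n * T\<bar> \<le> real n * (K * \<bar>p - a\<bar> ^ (2 * m + 1))"
      unfolding abs_mult using T n by (intro mult_mono) auto
    \<comment> \<open>The Taylor remainder has one power more than the leading term; the spare
      factor \<open>r\<close> is the convergence rate.\<close>
    have npa: "real n * \<bar>p - a\<bar> ^ (2 * m + 1) = r * \<bar>y / 2\<bar> ^ (2 * m + 1)"
    proof -
      have "real n * \<bar>p - a\<bar> ^ (2 * m + 1) = (real n * r ^ (2 * m)) * (r * \<bar>y / 2\<bar> ^ (2 * m + 1))"
        unfolding pa abs_mult power_mult_distrib using r by (simp add: mult_ac)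
      then show ?thesis using r(3) by simp
    qed
    have Y: "\<bar>y / 2\<bar> ^ (2 * m + 1) \<le> (1 + \<bar>y\<bar>) ^ (2 * m + 1)"
      by (intro power_mono) auto
    have Y1: "1 + \<bar>y / 2\<bar> \<le> (1 + \<bar>y\<bar>) ^ (2 * m + 1)"
    proof -
      have "1 + \<bar>y / 2\<bar> \<le> (1 + \<bar>y\<bar>) ^ 1" by simp
      also have "\<dots> \<le> (1 + \<bar>y\<bar>) ^ (2 * m + 1)" by (intro power_increasing) auto
      finally show ?thesis .
    qed
    have 1: "\<bar>u - v\<bar> \<le> (K + 2 / q) * r * (1 + \<bar>y\<bar>) ^ (2 * m + 1)"
    proof -
      have "\<bar>u - v\<bar> \<le> K * (real n * \<bar>p - a\<bar> ^ (2 * m + 1)) + 1 / q * (1 / real n + \<bar>p - a\<bar>)"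
        unfolding uv using nT E by (simp only: mult.left_commute[of K])
      also have "\<dots> \<le> K * (r * (1 + \<bar>y\<bar>) ^ (2 * m + 1)) + 1 / q * (r + \<bar>y / 2\<bar> * r)"
        unfolding npa using Y K r q
        by (intro add_mono mult_left_mono) (auto simp: pa abs_mult)
      also have "r + \<bar>y / 2\<bar> * r = r * (1 + \<bar>y / 2\<bar>)" by (simp add: algebra_simps)
      also have "1 / q * (r * (1 + \<bar>y / 2\<bar>)) \<le> 2 / q * (r * (1 + \<bar>y\<bar>) ^ (2 * m + 1))"
        using Y1 r q by (intro mult_mono divide_right_mono) auto
      finally show ?thesis by (simp add: algebra_simps)
    qed
    \<comment> \<open>By \<open>K * d <= c / 2\<close> the Taylor remainder uses at most half of the
      decay; the other errors are at most \<open>2 / q\<close> because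
      \<open>1 / n + |p - a| <= 2\<close>.\<close>
    have 2: "u \<le> v / 2 + 2 / q"
    proof -
      have "\<bar>p - a\<bar> ^ (2 * m + 1) = \<bar>p - a\<bar> * (p - a) ^ (2 * m)"
        by (simp add: power_mult)
      also have "K * \<dots> \<le> K * (d * (p - a) ^ (2 * m))"
        using K pd by (intro mult_left_mono mult_right_mono) (auto simp: power_mult)
      also have "\<dots> \<le> c / 2 * (p - a) ^ (2 * m)"
        using Kd by (simp only: mult.assoc[symmetric]) (intro mult_right_mono, auto simp: power_mult)
      finally have "T \<le> c / 2 * (p - a) ^ (2 * m)" using T by linarith
      then have "real n * T \<le> real n * (c / 2 * (p - a) ^ (2 * m))" using n by (intro mult_left_mono) auto
      also have "\<dots> = - v / 2" unfolding v_eq by simp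
      finally have a1: "real n * T \<le> - v / 2" .
      have "1 / real n + \<bar>p - a\<bar> \<le> 1 + 1" using n pd d by (intro add_mono) (auto simp: field_simps)
      then have "1 / q * (1 / real n + \<bar>p - a\<bar>) \<le> 1 / q * (1 + 1)" using q by (intro mult_left_mono) auto
      then show ?thesis using uv a1 E by simp
    qed
    have v0: "v \<le> 0" using c by (simp add: v_def power_mult)
    \<comment> \<open>As \<open>v <= 0\<close>, the number \<open>v / 2 + 2 / q\<close> bounds
      \<open>v\<close> as well as \<open>u\<close>.\<close>
    have "\<bar>exp u - exp v\<bar> \<le> \<bar>u - v\<bar> * exp (v / 2 + 2 / q)"
      using 2 v0 q by (intro abs_exp_diff_le) (auto intro: order_trans[of _ "v / 2"])
    also have "\<dots> \<le> (K + 2 / q) * r * (1 + \<bar>y\<bar>) ^ (2 * m + 1) * exp (v / 2 + 2 / q)"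
      using 1 by (intro mult_right_mono) auto
    also have "\<dots> = B * r * (1 + \<bar>y\<bar>) ^ (2 * m + 1) * exp (v / 2)"
      by (simp add: B_def exp_add)
    finally have "\<bar>exp u - exp v\<bar> \<le> B * r * (1 + \<bar>y\<bar>) ^ (2 * m + 1) * exp (v / 2)" .
    moreover have "exp u = spin_weight f n k / exp (real n * (f a + entropy_I a) - ln (real n) / 2 - L)"
      using pos by (simp add: u_def exp_diff)
    moreover have "exp v = quasi_gaussian c m y" by (simp add: v_def quasi_gaussian_def)
    moreover have "exp (v / 2) = quasi_gaussian (c / 2) m y" by (simp add: v_def quasi_gaussian_def)
    ultimately show ?thesis unfolding y_def r_def by simp
  qed
  ultimately show ?thesis using that[of B L] by blast
qed

end

section \<open>Test functions integrated against the limit density\<close>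

lemma quasi_gaussian_DERIV:
  "(quasi_gaussian c m has_real_derivative
    - c * real m * (x / 2) ^ (2 * m - 1) * quasi_gaussian c m x) (at x)"
proof -
  have "((\<lambda>x. - c * (x / 2) ^ N) has_real_derivative - c * (real N * (x / 2) ^ (N - 1) * (1 / 2))) (at x)" for N
    by (auto intro!: derivative_eq_intros)
  from DERIV_fun_exp[OF this[of "2 * m"]] show ?thesis
    unfolding quasi_gaussian_def[abs_def] by (simp add: mult_ac)
qed

lemma abs_quasi_gaussian [simp]: "\<bar>quasi_gaussian c m x\<bar> = quasi_gaussian c m x"
  by (simp add: quasi_gaussian_def)

lemma quasi_gaussian_borel [measurable]: "quasi_gaussian c m \<in> borel_measurable borel"
  unfolding quasi_gaussian_def[abs_def] by measurable

lemma linear_test_borel: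
  assumes "linear_test h"
  shows "h \<in> borel_measurable borel"
proof (rule borel_measurable_continuous_onI)
  have "1-lipschitz_on UNIV h"
    using assms by (intro lipschitz_onI) (auto simp: linear_test_def dist_real_def)
  then show "continuous_on UNIV h" by (rule lipschitz_on_continuous_on)
qed

text \<open>By \<open>1 + y^2 <= (1 + |y|)^2\<close>, a bound by the Cauchy kernel follows from a
  moment bound with two extra powers of \<open>1 + |y|\<close>.\<close>

lemma le_cauchy_kernel:
  fixes x y z p :: real
  assumes "x * (1 + \<bar>y\<bar>) ^ 2 \<le> z" "0 \<le> x"
  shows "x \<le> z / (1 + y\<^sup>2)"
proof -
  have "1 + y\<^sup>2 \<le> (1 + \<bar>y\<bar>) ^ 2" by (simp add: power2_eq_square algebra_simps)
  then have "x * (1 + y\<^sup>2) \<le> x * (1 + \<bar>y\<bar>) ^ 2" using assms(2) by (intro mult_left_mono) auto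
  then have "x * (1 + y\<^sup>2) \<le> z" using assms(1) by linarith
  moreover have "0 < 1 + y\<^sup>2" by (simp add: add_pos_nonneg)
  ultimately show ?thesis by (simp add: pos_le_divide_eq)
qed

lemma linear_test_quasi_gaussian_bound:
  assumes c: "0 < c" and m: "1 \<le> m"
  obtains B where "0 < B" "\<And>h x. linear_test h \<Longrightarrow> \<bar>h x * quasi_gaussian c m x\<bar> \<le> B / (1 + x\<^sup>2)"
    "\<And>h. linear_test h \<Longrightarrow> integrable lborel (\<lambda>x. h x * quasi_gaussian c m x)"
    "\<And>h. linear_test h \<Longrightarrow> \<bar>\<integral>x. h x * quasi_gaussian c m x \<partial>lborel\<bar> \<le> B * pi"
proof -
  \<comment> \<open>The exponent \<open>3\<close> is one power for the test function and two for the
    Cauchy kernel.\<close>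
  obtain B where B: "0 < B" "\<And>x. (1 + \<bar>x\<bar>) ^ 3 * quasi_gaussian c m x \<le> B"
    using quasi_gaussian_moment_bound[OF c m, where p = "3"] by blast
  have 1: "\<bar>h x * quasi_gaussian c m x\<bar> \<le> B / (1 + x\<^sup>2)" if "linear_test h" for h x
  proof (rule le_cauchy_kernel)
    have "\<bar>h x * quasi_gaussian c m x\<bar> * (1 + \<bar>x\<bar>) ^ 2 \<le> ((1 + \<bar>x\<bar>) * quasi_gaussian c m x) * (1 + \<bar>x\<bar>) ^ 2"
      using that by (intro mult_right_mono) (auto simp: linear_test_def abs_mult intro!: mult_right_mono)
    also have "\<dots> \<le> B" using B(2)[of x] by (simp add: power2_eq_square power3_eq_cube mult_ac)
    finally show "\<bar>h x * quasi_gaussian c m x\<bar> * (1 + \<bar>x\<bar>) ^ 2 \<le> B" .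
  qed simp
  have Bi: "integrable lborel (\<lambda>x. B * (1 / (1 + x\<^sup>2)))"
    by (intro integrable_mult_right integrable_cauchy_kernel)
  have 2: "integrable lborel (\<lambda>x. h x * quasi_gaussian c m x)" if h: "linear_test h" for h
    using 1[OF h] linear_test_borel[OF h]
    by (intro Bochner_Integration.integrable_bound[OF Bi]) (auto intro!: AE_I2 simp: B(1) less_imp_le abs_of_nonneg)
  have 3: "\<bar>\<integral>x. h x * quasi_gaussian c m x \<partial>lborel\<bar> \<le> B * pi" if h: "linear_test h" for h
  proof -
    have "\<bar>\<integral>x. h x * quasi_gaussian c m x \<partial>lborel\<bar> \<le> (\<integral>x. \<bar>h x * quasi_gaussian c m x\<bar> \<partial>lborel)"
      by (rule integral_abs_bound)
    also have "\<dots> \<le> (\<integral>x. B * (1 / (1 + x\<^sup>2)) \<partial>lborel)"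
      using 2[OF h] Bi 1[OF h] by (intro integral_mono) auto
    also have "\<dots> = B * pi" by (simp only: integral_mult_right_zero integrable_cauchy_kernel(2))
    finally show ?thesis .
  qed
  show ?thesis using that B(1) 1 2 3 by blast
qed

lemma linear_test_1: "linear_test (\<lambda>x. 1)"
  by (simp add: linear_test_def)

lemma quasi_gaussian_integral_pos:
  assumes c: "0 < c" and m: "1 \<le> m"
  shows "0 < (\<integral>x. quasi_gaussian c m x \<partial>lborel)"
proof -
  have i: "integrable lborel (quasi_gaussian c m)"
  proof (rule linear_test_quasi_gaussian_bound[OF c m])
    assume "\<And>h. linear_test h \<Longrightarrow> integrable lborel (\<lambda>x. h x * quasi_gaussian c m x)"
    from this[OF linear_test_1] show ?thesis by simp
  qed
  have "(\<integral>x. quasi_gaussian c m x \<partial>lborel) \<noteq> 0"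
  proof
    assume "(\<integral>x. quasi_gaussian c m x \<partial>lborel) = 0"
    then have "AE x in lborel. quasi_gaussian c m x = 0"
      using integral_nonneg_eq_0_iff_AE[OF i] by (simp add: less_imp_le)
    then have "AE x in (lborel :: real measure). False"
      by (rule AE_mp) (auto intro!: AE_I2 simp: quasi_gaussian_def)
    then show False using ae_filter_eq_bot_iff[of "lborel :: real measure"] by (simp add: trivial_limit_def)
  qed
  moreover have "0 \<le> (\<integral>x. quasi_gaussian c m x \<partial>lborel)"
    by (intro Bochner_Integration.integral_nonneg) (simp add: less_imp_le)
  ultimately show ?thesis by linarith
qed

section \<open>Sums over the window compared with integrals\<close>

context laplace_point
begin

text \<open>Product rule in finite form: \<open>h\<close> varies by at most \<open>e\<close>, the
  density by the mean value theorem. The bound is stated at \<open>y\<close>, the point at which the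
  integral is evaluated, rather than at the node \<open>x\<close>.\<close>

lemma quasi_gaussian_cell_bound:
  obtains B where "0 \<le> B"
    "\<forall>h x y e. linear_test h \<longrightarrow> 0 \<le> e \<longrightarrow> e \<le> 2 \<longrightarrow> x \<le> y \<longrightarrow> y \<le> x + e
      \<longrightarrow> \<bar>h x * quasi_gaussian c m x - h y * quasi_gaussian c m y\<bar> \<le> B * e / (1 + y\<^sup>2)"
proof -
  obtain B2 where B2: "0 < B2" "\<And>x. (1 + \<bar>x\<bar>) ^ 2 * quasi_gaussian c m x \<le> B2"
    using quasi_gaussian_moment_bound[OF c m, where p = "2"] by blast
  obtain B3 where B3: "0 < B3" "\<And>x. (1 + \<bar>x\<bar>) ^ (2 * m + 2) * quasi_gaussian c m x \<le> B3"
    using quasi_gaussian_moment_bound[OF c m, where p = "2 * m + 2"] by blast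
  \<comment> \<open>The factor \<open>27\<close> is \<open>3\<close> from the growth of
    \<open>h\<close> times \<open>3 ^ 2\<close> from moving the Cauchy weight to \<open>z\<close>;
    the exponent \<open>2 * m + 2\<close> in \<open>B3\<close> is
    \<open>1 + (2 * m - 1) + 2\<close>.\<close>
  define B where "B = B2 + 27 * (c * real m * B3)"
  have "0 \<le> B" using B2 B3 c by (simp add: B_def)
  moreover have "\<bar>h x * quasi_gaussian c m x - h y * quasi_gaussian c m y\<bar> \<le> B * e / (1 + y\<^sup>2)"
    if h: "linear_test h" and e: "0 \<le> e" "e \<le> 2" and xy: "x \<le> y" "y \<le> x + e" for h x y e
  proof (rule le_cauchy_kernel)
    let ?q = "quasi_gaussian c m"
    obtain z where z: "x \<le> z" "z \<le> y" "\<bar>?q y - ?q x\<bar> \<le> e * (c * real m * ((1 + \<bar>z\<bar>) ^ (2 * m - 1) * ?q z))"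
    proof (cases "x = y")
      case True
      then show ?thesis using that[of x] e c by (simp add: less_imp_le)
    next
      case False
      then obtain z where z: "x < z" "z < y" "?q y - ?q x = (y - x) * (- c * real m * (z / 2) ^ (2 * m - 1) * ?q z)"
        using MVT2[of x y ?q "\<lambda>x. - c * real m * (x / 2) ^ (2 * m - 1) * ?q x"] quasi_gaussian_DERIV xy by auto
      have "\<bar>z / 2\<bar> ^ (2 * m - 1) \<le> (1 + \<bar>z\<bar>) ^ (2 * m - 1)" by (intro power_mono) auto
      then have "\<bar>- c * real m * (z / 2) ^ (2 * m - 1) * ?q z\<bar> \<le> c * real m * ((1 + \<bar>z\<bar>) ^ (2 * m - 1) * ?q z)"
        using c by (auto simp: abs_mult power_abs mult.assoc less_imp_le intro!: mult_left_mono mult_right_mono)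
      then have "\<bar>?q y - ?q x\<bar> \<le> e * (c * real m * ((1 + \<bar>z\<bar>) ^ (2 * m - 1) * ?q z))"
        unfolding z(3) abs_mult[of "y - x"] using xy e by (intro mult_mono) auto
      then show ?thesis using that[of z] z by simp
    qed
    \<comment> \<open>All three points lie within distance \<open>2\<close> of each other, so
      \<open>1 + |.|\<close> changes by a factor of at most \<open>3\<close>.\<close>
    have x1: "1 + \<bar>x\<bar> \<le> 3 * (1 + \<bar>z\<bar>)" "1 + \<bar>y\<bar> \<le> 3 * (1 + \<bar>z\<bar>)"
      using z(1,2) xy e by (auto simp: abs_if)
    have "\<bar>h x * ?q x - h y * ?q y\<bar> = \<bar>(h x - h y) * ?q y - h x * (?q y - ?q x)\<bar>"
      by (simp add: algebra_simps)
    also have "\<dots> \<le> \<bar>h x - h y\<bar> * ?q y + \<bar>h x\<bar> * \<bar>?q y - ?q x\<bar>"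
      by (rule order_trans[OF abs_triangle_ineq4]) (simp add: abs_mult)
    also have "\<dots> \<le> e * ?q y + (3 * (1 + \<bar>z\<bar>)) * (e * (c * real m * ((1 + \<bar>z\<bar>) ^ (2 * m - 1) * ?q z)))"
    proof (intro add_mono mult_mono)
      have "\<bar>h x - h y\<bar> \<le> \<bar>x - y\<bar>" "\<bar>h x\<bar> \<le> 1 + \<bar>x\<bar>" using h by (auto simp: linear_test_def)
      then show "\<bar>h x - h y\<bar> \<le> e" "\<bar>h x\<bar> \<le> 3 * (1 + \<bar>z\<bar>)" using xy x1 by linarith+
      show "\<bar>?q y - ?q x\<bar> \<le> e * (c * real m * ((1 + \<bar>z\<bar>) ^ (2 * m - 1) * ?q z))" by (fact z(3))
    qed (use e in \<open>auto simp: less_imp_le\<close>)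
    finally have "\<bar>h x * ?q x - h y * ?q y\<bar> * (1 + \<bar>y\<bar>) ^ 2
      \<le> (e * ?q y + (3 * (1 + \<bar>z\<bar>)) * (e * (c * real m * ((1 + \<bar>z\<bar>) ^ (2 * m - 1) * ?q z)))) * (1 + \<bar>y\<bar>) ^ 2"
      by (rule mult_right_mono) simp
    also have "\<dots> = e * ((1 + \<bar>y\<bar>) ^ 2 * ?q y)
        + (3 * (1 + \<bar>z\<bar>)) * (e * (c * real m * ((1 + \<bar>z\<bar>) ^ (2 * m - 1) * ?q z))) * (1 + \<bar>y\<bar>) ^ 2"
    proof -
      have "(e * q + X) * Y = e * (Y * q) + X * Y" for q X Y :: real
        by (simp add: algebra_simps)
      then show ?thesis .
    qed
    also have "\<dots> \<le> e * B2 + (3 * (1 + \<bar>z\<bar>)) * (e * (c * real m * ((1 + \<bar>z\<bar>) ^ (2 * m - 1) * ?q z))) * (3 * (1 + \<bar>z\<bar>)) ^ 2"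
      using e x1 c B2(2)[of y] by (intro add_mono mult_left_mono power_mono) (auto simp: less_imp_le)
    also have "(3 * (1 + \<bar>z\<bar>)) * (e * (c * real m * ((1 + \<bar>z\<bar>) ^ (2 * m - 1) * ?q z))) * (3 * (1 + \<bar>z\<bar>)) ^ 2
      = 27 * (c * real m * ((1 + \<bar>z\<bar>) ^ (3 + (2 * m - 1)) * ?q z)) * e"
    proof -
      have "(3 * p) * (e * (C * (p ^ i * q))) * (3 * p) ^ 2 = 27 * (C * (p ^ (3 + i) * q)) * e" for p C q :: real and i
        by (simp add: power_add power3_eq_cube power2_eq_square)
      then show ?thesis .
    qed
    also have "3 + (2 * m - 1) = 2 * m + 2" using m by simp
    also have "e * B2 + 27 * (c * real m * ((1 + \<bar>z\<bar>) ^ (2 * m + 2) * ?q z)) * e \<le> e * B2 + 27 * (c * real m * B3) * e"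
      using e c B3(2)[of z] by (intro add_left_mono mult_right_mono mult_left_mono) auto
    also have "\<dots> = B * e" by (simp add: B_def algebra_simps)
    finally show "\<bar>h x * ?q x - h y * ?q y\<bar> * (1 + \<bar>y\<bar>) ^ 2 \<le> B * e" .
  qed simp
  ultimately show ?thesis using that by blast
qed

text \<open>The cells of the window cover everything up to one mesh of its ends: the left end
  \<open>x\<close> of the lattice cell around \<open>y\<close> would belong to the window if
  \<open>|x| < 2 * d / scale n\<close>.\<close>

lemma not_in_cell:
  assumes n: "1 \<le> n" and y: "\<And>k. k \<in> window n \<Longrightarrow> y \<notin> {node n k..<node n k + mesh n}"
  shows "2 * d / scale n - mesh n \<le> \<bar>y\<bar>"
proof -
  note r = scale[OF n] and s = mesh[OF n]
  \<comment> \<open>The lattice index is an integer at first; \<open>d < a\<close> and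
    \<open>d < 1 - a\<close> later place it strictly between \<open>0\<close> and
    \<open>n\<close>.\<close>
  define j where "j = \<lfloor>(y + 2 * a / scale n) / mesh n\<rfloor>"
  define x where "x = - 2 * a / scale n + mesh n * real_of_int j"
  have "real_of_int j \<le> (y + 2 * a / scale n) / mesh n" "(y + 2 * a / scale n) / mesh n < real_of_int j + 1"
    unfolding j_def by linarith+
  then have "real_of_int j * mesh n \<le> y + 2 * a / scale n" "y + 2 * a / scale n < (real_of_int j + 1) * mesh n"
    using s by (simp_all add: pos_le_divide_eq pos_divide_less_eq)
  then have xy: "x \<le> y" "y < x + mesh n" by (simp_all add: x_def algebra_simps)
  have "2 * d / scale n \<le> \<bar>x\<bar>"
  proof (rule ccontr)
    assume "\<not> 2 * d / scale n \<le> \<bar>x\<bar>"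
    then have "\<bar>x\<bar> < 2 * d / scale n" by simp
    then have "\<bar>x\<bar> * scale n < 2 * d" using r by (simp only: pos_less_divide_eq)
    moreover have "x * scale n = 2 * (real_of_int j / real n - a)"
      using r n by (simp add: x_def mesh_def field_simps)
    then have "\<bar>x\<bar> * scale n = 2 * \<bar>real_of_int j / real n - a\<bar>"
      using r by (metis abs_mult abs_numeral abs_of_pos)
    ultimately have jd: "\<bar>real_of_int j / real n - a\<bar> < d" by simp
    then have j: "0 < real_of_int j / real n" "real_of_int j / real n < 1" using d by linarith+
    then have "0 < j" "j < int n" using n by (auto simp: zero_less_divide_iff)
    then obtain k where k: "j = int k" "k \<le> n" by (metis less_imp_le zero_le_imp_eq_int of_nat_le_iff)
    then have "k \<in> window n" using jd by (simp add: window_def)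
    then show False using y[of k] xy k by (simp add: node_eq x_def)
  qed
  then show ?thesis using xy s by linarith
qed

text \<open>Here the pointwise asymptotics enter the Riemann sum bound. One constant and one
  threshold for \<open>n\<close> serve all test functions, as a supremum over them will be
  taken.\<close>

lemma weighted_sum_asymp:
  obtains B L where "0 \<le> B"
    "\<forall>\<^sub>F n in sequentially. \<forall>h. linear_test h \<longrightarrow>
      \<bar>mesh n * (\<Sum>k\<in>window n. h (node n k) * (spin_weight f n k / exp (real n * (f a + entropy_I a) - ln (real n) / 2 - L)))
        - (\<integral>x. h x * quasi_gaussian c m x \<partial>lborel)\<bar> \<le> B * scale n"
proof -
  obtain B1 L where B1: "0 \<le> B1" "\<forall>n\<ge>1. \<forall>k\<in>window n.
      \<bar>spin_weight f n k / exp (real n * (f a + entropy_I a) - ln (real n) / 2 - L)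
        - quasi_gaussian c m (node n k)\<bar>
      \<le> B1 * scale n * (1 + \<bar>node n k\<bar>) ^ (2 * m + 1) * quasi_gaussian (c / 2) m (node n k)"
    by (rule spin_weight_asymp) (rule that)
  define w where "w n k = spin_weight f n k / exp (real n * (f a + entropy_I a) - ln (real n) / 2 - L)" for n k
  \<comment> \<open>The exponent is \<open>2 * m + 1\<close> from the error of the weights, one for
    the test function and two for the Cauchy kernel.\<close>
  obtain B2 where B2: "0 < B2" "\<And>x. (1 + \<bar>x\<bar>) ^ (2 * m + 4) * quasi_gaussian (c / 2) m x \<le> B2"
    by (rule quasi_gaussian_moment_bound[of "c / 2" m "2 * m + 4"]) (use c m in auto)
  obtain B3 where B3: "0 \<le> B3" "\<forall>h x y e. linear_test h \<longrightarrow> 0 \<le> e \<longrightarrow> e \<le> 2 \<longrightarrow> x \<le> y \<longrightarrow> y \<le> x + e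
      \<longrightarrow> \<bar>h x * quasi_gaussian c m x - h y * quasi_gaussian c m y\<bar> \<le> B3 * e / (1 + y\<^sup>2)"
    by (rule quasi_gaussian_cell_bound) (rule that)
  \<comment> \<open>The fourth power serves the tail: one for the test function, two for the Cauchy
    kernel, one to be traded for \<open>scale n / d\<close>.\<close>
  obtain B4 where B4: "0 < B4" "\<And>x. (1 + \<bar>x\<bar>) ^ 4 * quasi_gaussian c m x \<le> B4"
    using quasi_gaussian_moment_bound[OF c m, where p = "4"] by blast
  \<comment> \<open>The summands are the error of the weights (\<open>9\<close> from moving the
    Cauchy weight within a cell), the discretization error (the mesh is at most
    \<open>2 * scale n\<close>), and the tail outside the cells.\<close>
  define B where "B = 9 * (B1 * B2) + 2 * B3 + B4 / d"
  have B: "0 \<le> B" "9 * (B1 * B2) + 2 * B3 \<le> B" "B4 / d \<le> B"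
    using B1 B2 B3 B4 d by (simp_all add: B_def)
  \<comment> \<open>This makes the mesh at most \<open>d / scale n\<close>, so points outside all
    cells satisfy \<open>|y| >= d / scale n\<close>.\<close>
  have "\<forall>\<^sub>F n in sequentially. scale n < d / 2"
    using scale_tendsto_0 d by (intro order_tendstoD) auto
  then have "\<forall>\<^sub>F n in sequentially. \<forall>h. linear_test h \<longrightarrow>
    \<bar>mesh n * (\<Sum>k\<in>window n. h (node n k) * w n k) - (\<integral>x. h x * quasi_gaussian c m x \<partial>lborel)\<bar>
      \<le> (B * scale n) * pi"
    using eventually_ge_at_top[of 1]
  proof eventually_elim
    case (elim n)
    note n = elim(2) and r = scale[OF elim(2)] and s = mesh[OF elim(2)]
    show ?case
    proof (intro allI impI)
      fix h assume h: "linear_test h"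
      have i: "integrable lborel (\<lambda>x. h x * quasi_gaussian c m x)"
        by (rule linear_test_quasi_gaussian_bound[OF c m]) (use h in blast)
      show "\<bar>mesh n * (\<Sum>k\<in>window n. h (node n k) * w n k) - (\<integral>x. h x * quasi_gaussian c m x \<partial>lborel)\<bar>
        \<le> (B * scale n) * pi"
      proof (rule riemann_sum_bound[where b = "- 2 * a / scale n"])
        fix k y assume k: "k \<in> window n" and y: "- 2 * a / scale n + mesh n * real k \<le> y"
          "y < - 2 * a / scale n + mesh n * real k + mesh n"
        define x where "x = node n k"
        have xy: "x \<le> y" "y \<le> x + mesh n" using y by (simp_all add: x_def node_eq)
        have y3: "1 + \<bar>y\<bar> \<le> 3 * (1 + \<bar>x\<bar>)" using xy s(1,3) by (auto simp: abs_if)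
        have hx: "\<bar>h x\<bar> \<le> 1 + \<bar>x\<bar>" using h by (simp add: linear_test_def)
        have 1: "\<bar>h x * (w n k - quasi_gaussian c m x)\<bar> \<le> 9 * (B1 * B2) * scale n / (1 + y\<^sup>2)"
        proof (rule le_cauchy_kernel)
          define W where "W = B1 * scale n * (1 + \<bar>x\<bar>) ^ (2 * m + 1) * quasi_gaussian (c / 2) m x"
          have W: "\<bar>w n k - quasi_gaussian c m x\<bar> \<le> W"
            unfolding W_def w_def x_def by (rule B1(2)[rule_format, OF n k])
          then have "\<bar>h x * (w n k - quasi_gaussian c m x)\<bar> * (1 + \<bar>y\<bar>) ^ 2
            \<le> ((1 + \<bar>x\<bar>) * W) * (3 * (1 + \<bar>x\<bar>)) ^ 2"
            unfolding abs_mult using hx y3 by (intro mult_mono power_mono) auto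
          also have "\<dots> = 9 * (B1 * ((1 + \<bar>x\<bar>) ^ (2 * m + 4) * quasi_gaussian (c / 2) m x)) * scale n"
          proof -
            have "(p * (B1 * r * p ^ i * q)) * (3 * p) ^ 2 = 9 * (B1 * (p ^ (i + 3) * q)) * r" for p q r :: real and i
              by (simp add: power_add power2_eq_square power3_eq_cube)
            from this[of _ _ "2 * m + 1"] have "((1 + \<bar>x\<bar>) * W) * (3 * (1 + \<bar>x\<bar>)) ^ 2 = 9 * (B1 * ((1 + \<bar>x\<bar>) ^ (2 * m + 1 + 3) * quasi_gaussian (c / 2) m x)) * scale n"
              unfolding W_def .
            then show ?thesis by (simp only: add.assoc) simp
          qed
          also have "\<dots> \<le> 9 * (B1 * B2) * scale n"
            using B1(1) B2(2)[of x] r by (intro mult_right_mono mult_left_mono) auto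
          finally show "\<bar>h x * (w n k - quasi_gaussian c m x)\<bar> * (1 + \<bar>y\<bar>) ^ 2 \<le> 9 * (B1 * B2) * scale n" .
        qed simp
        have "\<bar>h x * quasi_gaussian c m x - h y * quasi_gaussian c m y\<bar> \<le> B3 * mesh n / (1 + y\<^sup>2)"
          using B3(2)[rule_format, OF h _ _ xy] s by simp
        also have "\<dots> \<le> B3 * (2 * scale n) / (1 + y\<^sup>2)"
          using s B3(1) by (intro divide_right_mono mult_left_mono) auto
        finally have 2: "\<bar>h x * quasi_gaussian c m x - h y * quasi_gaussian c m y\<bar> \<le> B3 * (2 * scale n) / (1 + y\<^sup>2)" .
        have "\<bar>h x * w n k - h y * quasi_gaussian c m y\<bar>
          \<le> 9 * (B1 * B2) * scale n / (1 + y\<^sup>2) + B3 * (2 * scale n) / (1 + y\<^sup>2)"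
          using 1 2 by (simp only: right_diff_distrib)
        also have "\<dots> = (9 * (B1 * B2) + 2 * B3) * scale n / (1 + y\<^sup>2)"
          by (simp add: add_divide_distrib algebra_simps)
        also have "\<dots> \<le> B * scale n / (1 + y\<^sup>2)"
          using B r by (intro divide_right_mono mult_right_mono) auto
        finally show "\<bar>h (node n k) * w n k - h y * quasi_gaussian c m y\<bar> \<le> B * scale n / (1 + y\<^sup>2)"
          by (simp add: x_def)
      next
        fix y assume "\<And>k. k \<in> window n \<Longrightarrow> y \<notin> {- 2 * a / scale n + mesh n * real k..<- 2 * a / scale n + mesh n * real k + mesh n}"
        then have "2 * d / scale n - mesh n \<le> \<bar>y\<bar>" using n by (intro not_in_cell) (auto simp: node_eq)
        moreover have "mesh n \<le> d / scale n"
        proof -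
          have "2 * scale n * scale n \<le> 2 * scale n * 1" using r by (intro mult_left_mono) auto
          also have "\<dots> \<le> d" using elim(1) by simp
          finally have "2 * scale n \<le> d / scale n" using r by (simp add: field_simps)
          then show ?thesis using s by linarith
        qed
        ultimately have "d / scale n \<le> 1 + \<bar>y\<bar>" by simp
        \<comment> \<open>Far out, a factor \<open>1\<close> may be replaced by this one, which
          produces the rate.\<close>
        then have dy: "1 \<le> (1 + \<bar>y\<bar>) * scale n / d" using d r by (simp add: field_simps)
        show "\<bar>h y * quasi_gaussian c m y\<bar> \<le> B * scale n / (1 + y\<^sup>2)"
        proof (rule le_cauchy_kernel)
          have "\<bar>h y * quasi_gaussian c m y\<bar> * (1 + \<bar>y\<bar>) ^ 2 \<le> ((1 + \<bar>y\<bar>) * quasi_gaussian c m y) * (1 + \<bar>y\<bar>) ^ 2 * 1"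
            using h by (auto simp: linear_test_def abs_mult intro!: mult_right_mono)
          also have "\<dots> \<le> ((1 + \<bar>y\<bar>) * quasi_gaussian c m y) * (1 + \<bar>y\<bar>) ^ 2 * ((1 + \<bar>y\<bar>) * scale n / d)"
            using dy by (intro mult_left_mono) (auto simp: less_imp_le)
          also have "\<dots> = ((1 + \<bar>y\<bar>) ^ 4 * quasi_gaussian c m y) / d * scale n"
            by (simp add: power4_eq_xxxx power2_eq_square)
          also have "\<dots> \<le> B4 / d * scale n"
            using B4(2) d r by (intro mult_right_mono divide_right_mono) auto
          also have "\<dots> \<le> B * scale n" using B r by (intro mult_right_mono) auto
          finally show "\<bar>h y * quasi_gaussian c m y\<bar> * (1 + \<bar>y\<bar>) ^ 2 \<le> B * scale n" .
        qed simp
      qed (use i s in auto)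
    qed
  qed
  then have "\<forall>\<^sub>F n in sequentially. \<forall>h. linear_test h \<longrightarrow>
    \<bar>mesh n * (\<Sum>k\<in>window n. h (node n k) * w n k) - (\<integral>x. h x * quasi_gaussian c m x \<partial>lborel)\<bar>
      \<le> (B * pi) * scale n"
    by (simp only: mult_ac)
  then show ?thesis using that[of "B * pi" L] B by (simp add: w_def)
qed

text \<open>The exponential normalization and the mesh cancel in the quotient; the denominator is
  the numerator for the constant test \<open>1\<close>, hence at least \<open>Z / 2\<close>
  eventually.\<close>

lemma window_mean_asymp:
  obtains C where "0 \<le> C"
    "\<forall>\<^sub>F n in sequentially. \<forall>h. linear_test h \<longrightarrow>
      \<bar>(\<Sum>k\<in>window n. h (node n k) * spin_weight f n k) / (\<Sum>k\<in>window n. spin_weight f n k)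
        - (\<integral>x. h x * quasi_gaussian c m x \<partial>lborel) / (\<integral>x. quasi_gaussian c m x \<partial>lborel)\<bar> \<le> C * scale n"
proof -
  obtain B L where B: "0 \<le> B" "\<forall>\<^sub>F n in sequentially. \<forall>h. linear_test h \<longrightarrow>
      \<bar>mesh n * (\<Sum>k\<in>window n. h (node n k) * (spin_weight f n k / exp (real n * (f a + entropy_I a) - ln (real n) / 2 - L)))
        - (\<integral>x. h x * quasi_gaussian c m x \<partial>lborel)\<bar> \<le> B * scale n"
    by (rule weighted_sum_asymp) (rule that)
  define Z where "Z = (\<integral>x. quasi_gaussian c m x \<partial>lborel)"
  have Z: "0 < Z" unfolding Z_def by (rule quasi_gaussian_integral_pos[OF c m])
  obtain M where M: "0 < M" "\<And>h. linear_test h \<Longrightarrow> \<bar>\<integral>x. h x * quasi_gaussian c m x \<partial>lborel\<bar> \<le> M"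
  proof (rule linear_test_quasi_gaussian_bound[OF c m])
    fix B :: real
    assume "0 < B" "\<And>h. linear_test h \<Longrightarrow> \<bar>\<integral>x. h x * quasi_gaussian c m x \<partial>lborel\<bar> \<le> B * pi"
    then show ?thesis using that[of "B * pi"] by simp
  qed
  \<comment> \<open>From \<open>N / D - H / Z = ((N - H) * Z + H * (Z - D)) / (D * Z)\<close> with
    \<open>|H| <= M\<close> and \<open>D >= Z / 2\<close>.\<close>
  define C where "C = (Z + M) * B * 2 / Z\<^sup>2"
  have C: "0 \<le> C" using Z M B by (simp add: C_def)
  have "(\<lambda>n. B * scale n) \<longlonglongrightarrow> B * 0" by (intro tendsto_intros scale_tendsto_0)
  then have "\<forall>\<^sub>F n in sequentially. B * scale n < Z / 2" using Z by (intro order_tendstoD) auto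
  then have "\<forall>\<^sub>F n in sequentially. \<forall>h. linear_test h \<longrightarrow>
      \<bar>(\<Sum>k\<in>window n. h (node n k) * spin_weight f n k) / (\<Sum>k\<in>window n. spin_weight f n k)
        - (\<integral>x. h x * quasi_gaussian c m x \<partial>lborel) / Z\<bar> \<le> C * scale n"
    using B(2) eventually_ge_at_top[of 1]
  proof eventually_elim
    case (elim n)
    define e where "e = exp (real n * (f a + entropy_I a) - ln (real n) / 2 - L)"
    define N where "N h = mesh n * (\<Sum>k\<in>window n. h (node n k) * (spin_weight f n k / e))" for h
    note s = mesh[OF elim(3)] and r = scale[OF elim(3)]
    have e: "0 < e" by (simp add: e_def)
    have N: "\<bar>N h - (\<integral>x. h x * quasi_gaussian c m x \<partial>lborel)\<bar> \<le> B * scale n" if "linear_test h" for h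
      using elim(2) that unfolding N_def e_def by blast
    have N_eq: "N h = mesh n / e * (\<Sum>k\<in>window n. h (node n k) * spin_weight f n k)" for h
      by (simp add: N_def sum_distrib_left sum_divide_distrib)
    define D where "D = N (\<lambda>_. 1)"
    have D: "\<bar>D - Z\<bar> \<le> B * scale n" using N[OF linear_test_1] by (simp add: Z_def D_def)
    then have D2: "Z / 2 \<le> D" using elim(1) by linarith
    show ?case
    proof (intro allI impI)
      fix h assume h: "linear_test h"
      define H where "H = (\<integral>x. h x * quasi_gaussian c m x \<partial>lborel)"
      have "(\<Sum>k\<in>window n. h (node n k) * spin_weight f n k) / (\<Sum>k\<in>window n. spin_weight f n k) = N h / D"
        unfolding D_def N_eq using s e by simp
      then have "\<bar>(\<Sum>k\<in>window n. h (node n k) * spin_weight f n k) / (\<Sum>k\<in>window n. spin_weight f n k) - H / Z\<bar>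
        = \<bar>(N h - H) * Z + H * (Z - D)\<bar> / (D * Z)"
        using Z D2 by (simp add: diff_frac_eq abs_divide algebra_simps)
      also have "\<dots> \<le> ((Z + M) * (B * scale n)) / (Z / 2 * Z)"
      proof (intro frac_le mult_right_mono)
        have "\<bar>(N h - H) * Z + H * (Z - D)\<bar> \<le> \<bar>N h - H\<bar> * Z + \<bar>H\<bar> * \<bar>Z - D\<bar>"
          using Z by (intro order_trans[OF abs_triangle_ineq]) (simp add: abs_mult)
        also have "\<dots> \<le> (B * scale n) * Z + M * (B * scale n)"
          using N[OF h] D M(2)[OF h] M(1) Z B r by (intro add_mono mult_mono) (auto simp: H_def abs_minus_commute)
        finally show "\<bar>(N h - H) * Z + H * (Z - D)\<bar> \<le> (Z + M) * (B * scale n)" by (simp add: algebra_simps)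
      qed (use Z M B r D2 in auto)
      also have "\<dots> = C * scale n" by (simp add: C_def power2_eq_square)
      finally show "\<bar>(\<Sum>k\<in>window n. h (node n k) * spin_weight f n k) / (\<Sum>k\<in>window n. spin_weight f n k)
        - (\<integral>x. h x * quasi_gaussian c m x \<partial>lborel) / Z\<bar> \<le> C * scale n"
        by (simp only: H_def)
    qed
  qed
  then show ?thesis using that C unfolding Z_def by blast
qed

text \<open>The constant test \<open>1\<close> gives the total mass. The mesh is kept as a factor
  because it alone carries the dependence of the order of magnitude on \<open>m\<close>.\<close>

lemma window_mass_asymp:
  obtains b where "0 < b"
    "(\<lambda>n. (\<Sum>k\<in>window n. spin_weight f n k) * exp (- (real n * (f a + entropy_I a))) * sqrt (real n) * mesh n) \<longlonglongrightarrow> b"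
proof -
  obtain B L where B: "0 \<le> B" "\<forall>\<^sub>F n in sequentially. \<forall>h. linear_test h \<longrightarrow>
      \<bar>mesh n * (\<Sum>k\<in>window n. h (node n k) * (spin_weight f n k / exp (real n * (f a + entropy_I a) - ln (real n) / 2 - L)))
        - (\<integral>x. h x * quasi_gaussian c m x \<partial>lborel)\<bar> \<le> B * scale n"
    by (rule weighted_sum_asymp) (rule that)
  define Z where "Z = (\<integral>x. quasi_gaussian c m x \<partial>lborel)"
  have Z: "0 < Z" unfolding Z_def by (rule quasi_gaussian_integral_pos[OF c m])
  define u where "u n = (\<Sum>k\<in>window n. spin_weight f n k) * exp (- (real n * (f a + entropy_I a))) * sqrt (real n) * mesh n" for n
  have "\<forall>\<^sub>F n in sequentially. \<bar>exp L * u n - Z\<bar> \<le> B * scale n"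
    using B(2) eventually_ge_at_top[of 1]
  proof eventually_elim
    case (elim n)
    have "exp (ln (real n) / 2) = sqrt (real n)"
      using elim by (simp add: ln_sqrt[symmetric])
    then have "exp (real n * (f a + entropy_I a) - ln (real n) / 2 - L) = exp (real n * (f a + entropy_I a)) / sqrt (real n) / exp L"
      by (simp only: exp_diff)
    then have "mesh n * (\<Sum>k\<in>window n. 1 * (spin_weight f n k / exp (real n * (f a + entropy_I a) - ln (real n) / 2 - L))) = exp L * u n"
      by (simp only: mult_1 sum_divide_distrib[symmetric] u_def exp_minus) (simp add: field_simps)
    then show ?case using elim(1)[rule_format, OF linear_test_1] unfolding Z_def by simp
  qed
  then have ev: "\<forall>\<^sub>F n in sequentially. norm (exp L * u n - Z) \<le> B * scale n" by (simp only: real_norm_def)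
  have "(\<lambda>n. B * scale n) \<longlonglongrightarrow> 0" using tendsto_mult_right_zero[OF scale_tendsto_0] by simp
  from Lim_null_comparison[OF ev this] have "(\<lambda>n. exp L * u n - Z) \<longlonglongrightarrow> 0"
    .
  from tendsto_mult_left[OF tendsto_add[OF this tendsto_const[of Z]], of "exp (- L)"]
  have "u \<longlonglongrightarrow> exp (- L) * Z" by (simp add: mult.assoc[symmetric] exp_add[symmetric])
  then show ?thesis using that[of "exp (- L) * Z"] Z by (simp add: u_def[abs_def])
qed

end

section \<open>From Gibbs measures to sums over the number of plus spins\<close>

definition num_plus :: "nat \<Rightarrow> (nat \<Rightarrow> real) \<Rightarrow> nat" where
  "num_plus n \<omega> = card {i \<in> {1..n}. \<omega> i = 1}"

lemma frac_plus_num_plus: "frac_plus n \<omega> = real (num_plus n \<omega>) / real n"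
  by (simp add: frac_plus_def num_plus_def)

lemma finite_configs [simp]: "finite (configs n)"
  unfolding configs_def by (intro finite_PiE) auto

lemma magnetization_num_plus:
  assumes "\<omega> \<in> configs n"
  shows "magnetization n \<omega> = 2 * real (num_plus n \<omega>) - real n"
proof -
  have "magnetization n \<omega> = (\<Sum>i=1..n. 2 * of_bool (\<omega> i = 1) - 1)"
    unfolding magnetization_def
  proof (rule sum.cong)
    fix i assume "i \<in> {1..n}"
    then have "\<omega> i \<in> {1, -1}" using assms by (auto simp: configs_def)
    then show "\<omega> i = 2 * of_bool (\<omega> i = 1) - 1" by auto
  qed simp
  also have "\<dots> = 2 * (\<Sum>i=1..n. of_bool (\<omega> i = 1)) - real n"
    by (simp add: sum_subtractf sum_distrib_left)
  also have "(\<Sum>i=1..n. of_bool (\<omega> i = 1)) = real (num_plus n \<omega>)"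
    unfolding num_plus_def by (subst sum_of_bool_eq) (auto intro!: arg_cong[of _ _ card])
  finally show ?thesis .
qed

text \<open>A configuration is identified with its set of plus spins, and subsets are grouped by
  cardinality.\<close>

lemma sum_configs_num_plus:
  fixes G :: "nat \<Rightarrow> real"
  shows "(\<Sum>\<omega>\<in>configs n. G (num_plus n \<omega>)) = (\<Sum>k\<le>n. real (n choose k) * G k)"
proof -
  \<comment> \<open>The value \<open>undefined\<close> outside \<open>{1..n}\<close> is forced by
    the extensional function space in \<open>configs\<close>.\<close>
  define \<phi> where "\<phi> T = (\<lambda>i. if i \<in> {1..n} then (if i \<in> T then 1 else -1) else undefined :: real)" for T
  have bij: "bij_betw \<phi> (Pow {1..n}) (configs n)"
  proof (rule bij_betwI[where g = "\<lambda>\<omega>. {i \<in> {1..n}. \<omega> i = 1}"])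
    show "\<phi> \<in> Pow {1..n} \<rightarrow> configs n" by (auto simp: \<phi>_def configs_def)
    show "(\<lambda>\<omega>. {i \<in> {1..n}. \<omega> i = 1}) \<in> configs n \<rightarrow> Pow {1..n}" by auto
    show "{i \<in> {1..n}. \<phi> T i = 1} = T" if "T \<in> Pow {1..n}" for T
      using that by (auto simp: \<phi>_def)
    show "\<phi> {i \<in> {1..n}. \<omega> i = 1} = \<omega>" if "\<omega> \<in> configs n" for \<omega>
      using that by (auto simp: \<phi>_def configs_def PiE_def extensional_def Pi_def fun_eq_iff)
  qed
  have np: "num_plus n (\<phi> T) = card T" if "T \<in> Pow {1..n}" for T
  proof -
    have "{i \<in> {1..n}. \<phi> T i = 1} = T" using that by (auto simp: \<phi>_def)
    then show ?thesis by (simp add: num_plus_def)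
  qed
  have "(\<Sum>\<omega>\<in>configs n. G (num_plus n \<omega>)) = (\<Sum>T\<in>Pow {1..n}. G (card T))"
    using np by (subst sum.reindex_bij_betw[OF bij, symmetric]) simp
  also have "\<dots> = (\<Sum>k\<le>n. \<Sum>T\<in>{T \<in> Pow {1..n}. card T = k}. G (card T))"
    by (rule sum.group[symmetric]) (auto simp: card_mono[of "{1..n}", simplified])
  also have "\<dots> = (\<Sum>k\<le>n. real (n choose k) * G k)"
    using n_subsets[of "{1..n}"] by (intro sum.cong) (auto simp: Pow_def)
  finally show ?thesis .
qed

lemma sum_configs_weight:
  "(\<Sum>\<omega>\<in>{\<omega> \<in> configs n. frac_plus n \<omega> \<in> S}. G (num_plus n \<omega>) * exp (real n * f (frac_plus n \<omega>)))
    = (\<Sum>k | k \<le> n \<and> real k / real n \<in> S. G k * spin_weight f n k)"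
proof -
  define H where "H k = (if real k / real n \<in> S then G k * exp (real n * f (real k / real n)) else 0)" for k
  have "(\<Sum>\<omega>\<in>{\<omega> \<in> configs n. frac_plus n \<omega> \<in> S}. G (num_plus n \<omega>) * exp (real n * f (frac_plus n \<omega>)))
    = (\<Sum>\<omega>\<in>configs n. H (num_plus n \<omega>))"
    by (simp add: H_def frac_plus_num_plus sum.inter_filter)
  also have "\<dots> = (\<Sum>k\<le>n. real (n choose k) * H k)" by (rule sum_configs_num_plus)
  also have "\<dots> = (\<Sum>k | k \<le> n \<and> real k / real n \<in> S. G k * spin_weight f n k)"
    unfolding H_def spin_weight_def
    by (intro sum.mono_neutral_cong_right) (auto simp: mult_ac)
  finally show ?thesis .
qed

lemma uniform_point_measure:
  assumes A: "finite A" "E \<subseteq> A" and p: "\<And>x. x \<in> A \<Longrightarrow> 0 \<le> p x" and pos: "0 < sum p E"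
  shows "uniform_measure (point_measure A (\<lambda>x. ennreal (p x))) E
    = point_measure A (\<lambda>x. ennreal (p x * indicator E x / sum p E))"
proof -
  have e: "emeasure (point_measure A (\<lambda>x. ennreal (p x))) E = ennreal (sum p E)"
    using A p by (subst emeasure_point_measure_finite) (auto intro!: sum_ennreal)
  have "uniform_measure (point_measure A (\<lambda>x. ennreal (p x))) E
    = density (count_space A) (\<lambda>x. ennreal (p x) * (indicator E x / ennreal (sum p E)))"
    unfolding uniform_measure_def e by (simp add: point_measure_def density_density_eq)
  also have "\<dots> = point_measure A (\<lambda>x. ennreal (p x * indicator E x / sum p E))"
    unfolding point_measure_def
  proof (intro density_cong)
    show "AE x in count_space A. ennreal (p x) * (indicator E x / ennreal (sum p E)) = ennreal (p x * indicator E x / sum p E)"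
      using p pos by (auto simp: AE_count_space indicator_def divide_ennreal ennreal_mult[symmetric] divide_ennreal_def inverse_ennreal divide_inverse)
  qed auto
  finally show ?thesis .
qed

lemma spin_weight_pos: "k \<le> n \<Longrightarrow> 0 < spin_weight f n k"
  by (simp add: spin_weight_def zero_less_binomial)

lemma partition_function_pos: "0 < (\<Sum>\<eta>\<in>configs n. exp (real n * f (frac_plus n \<eta>)))"
proof (rule sum_pos)
  show "configs n \<noteq> {}" by (simp add: configs_def PiE_eq_empty_iff)
qed auto

text \<open>The partition function cancels from the conditional mean. Nonemptiness makes the
  conditioning event have positive mass; otherwise the conditional law would be the null
  measure.\<close>

lemma integral_cond_law:
  assumes ne: "{k. k \<le> n \<and> real k / real n \<in> S} \<noteq> {}" and h: "h \<in> borel_measurable borel"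
  shows "(\<integral>x. h x \<partial>cond_law f n S (\<lambda>\<omega>. g (num_plus n \<omega>)))
    = (\<Sum>k | k \<le> n \<and> real k / real n \<in> S. h (g k) * spin_weight f n k)
      / (\<Sum>k | k \<le> n \<and> real k / real n \<in> S. spin_weight f n k)"
proof -
  define Z where "Z = (\<Sum>\<eta>\<in>configs n. exp (real n * f (frac_plus n \<eta>)))"
  have Z: "0 < Z" unfolding Z_def by (rule partition_function_pos)
  define p where "p \<omega> = exp (real n * f (frac_plus n \<omega>)) / Z" for \<omega>
  define E where "E = {\<omega> \<in> configs n. frac_plus n \<omega> \<in> S}"
  have p: "0 < p \<omega>" for \<omega> using Z by (simp add: p_def)
  have sumE: "(\<Sum>\<omega>\<in>E. G (num_plus n \<omega>) * p \<omega>) = (\<Sum>k | k \<le> n \<and> real k / real n \<in> S. G k * spin_weight f n k) / Z" for G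
    unfolding p_def E_def using sum_configs_weight[where n = n and S = S and G = G and f = f] by (simp add: sum_divide_distrib[symmetric])
  have sumE1: "sum p E = (\<Sum>k | k \<le> n \<and> real k / real n \<in> S. spin_weight f n k) / Z"
    using sumE[of "\<lambda>_. 1"] by simp
  have W: "0 < (\<Sum>k | k \<le> n \<and> real k / real n \<in> S. spin_weight f n k)"
    using ne by (intro sum_pos spin_weight_pos) auto
  have pos: "0 < sum p E" unfolding sumE1 using W Z by simp
  have law: "cond_law f n S (\<lambda>\<omega>. g (num_plus n \<omega>))
    = distr (point_measure (configs n) (\<lambda>\<omega>. ennreal (p \<omega> * indicator E \<omega> / sum p E))) borel (\<lambda>\<omega>. g (num_plus n \<omega>))"
  proof -
    have "gibbs f n = point_measure (configs n) (\<lambda>\<omega>. ennreal (p \<omega>))"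
      by (simp add: gibbs_def p_def Z_def)
    moreover have "uniform_measure (point_measure (configs n) (\<lambda>\<omega>. ennreal (p \<omega>))) E
      = point_measure (configs n) (\<lambda>\<omega>. ennreal (p \<omega> * indicator E \<omega> / sum p E))"
      using p pos by (intro uniform_point_measure) (auto simp: E_def less_imp_le)
    ultimately show ?thesis unfolding cond_law_def E_def by simp
  qed
  have "(\<integral>x. h x \<partial>cond_law f n S (\<lambda>\<omega>. g (num_plus n \<omega>)))
    = (\<Sum>\<omega>\<in>configs n. (p \<omega> * indicator E \<omega> / sum p E) * h (g (num_plus n \<omega>)))"
    unfolding law using h p pos
    by (subst integral_distr) (auto simp: lebesgue_integral_point_measure_finite less_imp_le)
  also have "\<dots> = (\<Sum>\<omega>\<in>E. h (g (num_plus n \<omega>)) * p \<omega>) / sum p E"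
    unfolding sum_divide_distrib E_def
    by (intro sum.mono_neutral_cong_right) (auto simp: mult_ac)
  also have "\<dots> = (\<Sum>k | k \<le> n \<and> real k / real n \<in> S. h (g k) * spin_weight f n k)
      / (\<Sum>k | k \<le> n \<and> real k / real n \<in> S. spin_weight f n k)"
    unfolding sumE1 sumE[of "\<lambda>k. h (g k)"] using Z by simp
  finally show ?thesis .
qed

lemma gibbs_prob:
  "measure (gibbs f n) {\<omega> \<in> configs n. frac_plus n \<omega> \<in> S}
    = (\<Sum>k | k \<le> n \<and> real k / real n \<in> S. spin_weight f n k) / (\<Sum>k\<le>n. spin_weight f n k)"
proof -
  define Z where "Z = (\<Sum>\<eta>\<in>configs n. exp (real n * f (frac_plus n \<eta>)))"
  have Z: "0 < Z" unfolding Z_def by (rule partition_function_pos)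
  have "measure (gibbs f n) {\<omega> \<in> configs n. frac_plus n \<omega> \<in> S}
    = (\<Sum>\<omega>\<in>{\<omega> \<in> configs n. frac_plus n \<omega> \<in> S}. exp (real n * f (frac_plus n \<omega>)) / Z)"
    unfolding gibbs_def Z_def[symmetric] measure_def using Z
    by (subst emeasure_point_measure_finite) (auto simp: sum_ennreal sum_nonneg)
  also have "\<dots> = (\<Sum>k | k \<le> n \<and> real k / real n \<in> S. spin_weight f n k) / Z"
    using sum_configs_weight[where n = n and S = S and G = "\<lambda>_. 1" and f = f] by (simp add: sum_divide_distrib[symmetric])
  also have "Z = (\<Sum>k\<le>n. spin_weight f n k)"
    using sum_configs_weight[where n = n and S = UNIV and G = "\<lambda>_. 1" and f = f] by (simp add: Z_def atMost_def)
  finally show ?thesis .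
qed

lemma prob_space_gibbs: "prob_space (gibbs f n)"
proof (rule prob_spaceI)
  define Z where "Z = (\<Sum>\<eta>\<in>configs n. exp (real n * f (frac_plus n \<eta>)))"
  have Z: "0 < Z" unfolding Z_def by (rule partition_function_pos)
  have "emeasure (gibbs f n) (space (gibbs f n)) = ennreal (\<Sum>\<omega>\<in>configs n. exp (real n * f (frac_plus n \<omega>)) / Z)"
    unfolding gibbs_def Z_def[symmetric] space_point_measure using Z
    by (subst emeasure_point_measure_finite) (auto simp: sum_ennreal)
  also have "\<dots> = 1" using Z by (simp add: sum_divide_distrib[symmetric] Z_def)
  finally show "emeasure (gibbs f n) (space (gibbs f n)) = 1" .
qed

lemma cond_law_cong:
  assumes "\<And>\<omega>. \<omega> \<in> configs n \<Longrightarrow> X \<omega> = Y \<omega>"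
  shows "cond_law f n S X = cond_law f n S Y"
  unfolding cond_law_def using assms
  by (intro distr_cong) (auto simp: gibbs_def space_point_measure)

section \<open>The Wasserstein bound near a maximizer\<close>

context laplace_point
begin

text \<open>After subtracting \<open>h 0\<close> from both expectations, every test function is a
  linear test, and the uniform estimate for window means bounds the whole supremum.\<close>

lemma wasserstein_cond_law:
  assumes X: "\<And>n \<omega>. 1 \<le> n \<Longrightarrow> \<omega> \<in> configs n \<Longrightarrow> X n \<omega> = 2 * (frac_plus n \<omega> - a) / scale n"
  shows "\<exists>C. \<forall>\<^sub>F n in sequentially.
    wasserstein (cond_law f n {a - d<..<a + d} (X n)) (proportional_law (quasi_gaussian c m))
      \<le> ennreal (C * scale n)"
proof -
  obtain C where C: "0 \<le> C" "\<forall>\<^sub>F n in sequentially. \<forall>h. linear_test h \<longrightarrow>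
      \<bar>(\<Sum>k\<in>window n. h (node n k) * spin_weight f n k) / (\<Sum>k\<in>window n. spin_weight f n k)
        - (\<integral>x. h x * quasi_gaussian c m x \<partial>lborel) / (\<integral>x. quasi_gaussian c m x \<partial>lborel)\<bar> \<le> C * scale n"
    by (rule window_mean_asymp) (rule that)
  define Z where "Z = (\<integral>x. quasi_gaussian c m x \<partial>lborel)"
  have Z: "0 < Z" unfolding Z_def by (rule quasi_gaussian_integral_pos[OF c m])
  have "\<forall>\<^sub>F n in sequentially. C * scale n < 1"
    using tendsto_mult_right_zero[OF scale_tendsto_0, of C] by (intro order_tendstoD) auto
  then have "\<forall>\<^sub>F n in sequentially.
    wasserstein (cond_law f n {a - d<..<a + d} (X n)) (proportional_law (quasi_gaussian c m))
      \<le> ennreal (C * scale n)"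
    using C(2) eventually_ge_at_top[of 1]
  proof eventually_elim
    case (elim n)
    have win: "{k. k \<le> n \<and> real k / real n \<in> {a - d<..<a + d}} = window n"
      by (auto simp: window_def abs_less_iff)
    \<comment> \<open>For an empty window the quotient of sums is \<open>0 / 0 = 0\<close>, whereas
      for the constant test \<open>1\<close> it must be within \<open>C * scale n < 1\<close> of
      \<open>1\<close>.\<close>
    have ne: "window n \<noteq> {}"
      using elim(1) elim(2)[rule_format, OF linear_test_1] Z by (auto simp: Z_def)
    then have W: "0 < (\<Sum>k\<in>window n. spin_weight f n k)"
      by (intro sum_pos spin_weight_pos) (auto simp: window_def)
    have law: "cond_law f n {a - d<..<a + d} (X n) = cond_law f n {a - d<..<a + d} (\<lambda>\<omega>. node n (num_plus n \<omega>))"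
      using X[OF elim(3)] by (intro cond_law_cong) (simp add: node_def frac_plus_num_plus)
    show ?case
      unfolding wasserstein_def
    proof (rule SUP_least, rule ennreal_leI)
      fix h :: "real \<Rightarrow> real"
      assume "h \<in> {h. \<forall>x. h differentiable at x \<and> \<bar>deriv h x\<bar> \<le> 1}"
      then have hd: "(h has_real_derivative deriv h z) (at z within UNIV)" "\<bar>deriv h z\<bar> \<le> 1" for z
        using DERIV_deriv_iff_real_differentiable by auto
      have lip: "\<bar>h x - h y\<bar> \<le> \<bar>x - y\<bar>" for x y
        using field_differentiable_bound[of UNIV h "deriv h" 1 x y] hd by auto
      define g where "g x = h x - h 0" for x
      have g: "linear_test g" unfolding linear_test_def g_def
        using lip lip[of _ 0] by (smt (verit) diff_0_right)
      have hb: "h \<in> borel_measurable borel"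
        by (intro borel_measurable_continuous_onI continuous_at_imp_continuous_on ballI)
          (use hd(1) DERIV_isCont in auto)
      have "(\<integral>x. h x \<partial>cond_law f n {a - d<..<a + d} (X n))
        = (\<Sum>k\<in>window n. h (node n k) * spin_weight f n k) / (\<Sum>k\<in>window n. spin_weight f n k)"
        unfolding law using integral_cond_law[where n = n and S = "{a - d<..<a + d}" and g = "node n", unfolded win, OF ne hb] .
      also have "\<dots> = (\<Sum>k\<in>window n. g (node n k) * spin_weight f n k) / (\<Sum>k\<in>window n. spin_weight f n k) + h 0"
        using W by (simp add: g_def left_diff_distrib sum_subtractf sum_distrib_left[symmetric] diff_divide_distrib)
      finally have P: "(\<integral>x. h x \<partial>cond_law f n {a - d<..<a + d} (X n))
        = (\<Sum>k\<in>window n. g (node n k) * spin_weight f n k) / (\<Sum>k\<in>window n. spin_weight f n k) + h 0" .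
      have int: "integrable lborel (\<lambda>x. h x * quasi_gaussian c m x)" if "linear_test h" for h
        by (rule linear_test_quasi_gaussian_bound[OF c m]) (use that in blast)
      have "(\<integral>x. h x \<partial>proportional_law (quasi_gaussian c m)) = (\<integral>x. (quasi_gaussian c m x / Z) *\<^sub>R h x \<partial>lborel)"
        unfolding proportional_law_def Z_def[symmetric] using hb Z
        by (intro integral_density) (auto intro!: AE_I2 simp: less_imp_le)
      also have "\<dots> = (\<integral>x. g x * quasi_gaussian c m x + h 0 * (1 * quasi_gaussian c m x) \<partial>lborel) / Z"
        by (simp add: g_def algebra_simps)
      also have "(\<integral>x. g x * quasi_gaussian c m x + h 0 * (1 * quasi_gaussian c m x) \<partial>lborel)
        = (\<integral>x. g x * quasi_gaussian c m x \<partial>lborel) + h 0 * (\<integral>x. 1 * quasi_gaussian c m x \<partial>lborel)"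
        using int[OF g] int[OF linear_test_1]
        by (subst Bochner_Integration.integral_add) (auto simp del: mult_1)
      also have "\<dots> / Z = (\<integral>x. g x * quasi_gaussian c m x \<partial>lborel) / Z + h 0"
        using Z by (simp add: add_divide_distrib Z_def)
      finally have Q: "(\<integral>x. h x \<partial>proportional_law (quasi_gaussian c m)) = (\<integral>x. g x * quasi_gaussian c m x \<partial>lborel) / Z + h 0" .
      show "\<bar>(\<integral>x. h x \<partial>cond_law f n {a - d<..<a + d} (X n)) - (\<integral>x. h x \<partial>proportional_law (quasi_gaussian c m))\<bar> \<le> C * scale n"
        unfolding P Q Z_def using elim(2)[rule_format, OF g] by simp
    qed
  qed
  then show ?thesis by blast
qed

end

section \<open>The free energy of the six-spin model\<close>

text \<open>The numerators of \<open>\<beta>\<close> and of \<open>h\<close> are small differences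
  of numbers of order one, so several digits are needed. Splitting off powers of \<open>2\<close>
  leaves arguments near \<open>1\<close>, where few terms of the logarithm series suffice.\<close>

lemma ln_10_bounds: "2.302584 \<le> ln (10::real)" "ln (10::real) \<le> 2.302586"
  and ln_19_bounds: "2.944438 \<le> ln (19::real)" "ln (19::real) \<le> 2.944440"
proof -
  have l2: "0.6931471 \<le> ln (2::real)" "ln (2::real) \<le> 0.6931473"
    using ln_approx_bounds[of 2 7] by (simp_all add: eval_nat_numeral)
  have l5: "0.2231435 \<le> ln (5 / 4 :: real)" "ln (5 / 4 :: real) \<le> 0.2231436"
    using ln_approx_bounds[of "5 / 4" 4] by (simp_all add: eval_nat_numeral)
  have l19: "0.1718502 \<le> ln (19 / 16 :: real)" "ln (19 / 16 :: real) \<le> 0.1718503"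
    using ln_approx_bounds[of "19 / 16" 4] by (simp_all add: eval_nat_numeral)
  have "ln (10::real) = ln (2 ^ 3 * (5 / 4))" by simp
  also have "\<dots> = 3 * ln 2 + ln (5 / 4)" by (subst ln_mult) (simp_all only: ln_realpow, simp_all)
  finally show "2.302584 \<le> ln (10::real)" "ln (10::real) \<le> 2.302586" using l2 l5 by simp_all
  have "ln (19::real) = ln (2 ^ 4 * (19 / 16))" by simp
  also have "\<dots> = 4 * ln 2 + ln (19 / 16)" by (subst ln_mult) (simp_all only: ln_realpow, simp_all)
  finally show "2.944438 \<le> ln (19::real)" "ln (19::real) \<le> 2.944440" using l2 l19 by simp_all
qed

section \<open>The entropy: derivative and continuity up to the boundary\<close>

lemma entropy_E_DERIV:
  assumes "- 1 < t" "t < 1"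
  shows "(entropy_E has_real_derivative (ln (1 - t) - ln (1 + t)) / 2) (at t)"
proof -
  have "((\<lambda>t. (1 + t) * ln (1 + t)) has_real_derivative ln (1 + t) + 1) (at t)"
    "((\<lambda>t. (1 - t) * ln (1 - t)) has_real_derivative - ln (1 - t) - 1) (at t)"
    using assms by (auto intro!: derivative_eq_intros)
  then have "((\<lambda>t. - ((1 + t) * ln (1 + t) + (1 - t) * ln (1 - t)) / 2) has_real_derivative
    - ((ln (1 + t) + 1) + (- ln (1 - t) - 1)) / 2) (at t)"
    by (intro DERIV_cdivide DERIV_minus DERIV_add)
  moreover have "entropy_E = (\<lambda>t. - ((1 + t) * ln (1 + t) + (1 - t) * ln (1 - t)) / 2)"
    by (simp add: entropy_E_def fun_eq_iff field_simps)
  ultimately show ?thesis by simp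
qed

lemma entropy_E_9_10: "entropy_E (9 / 10) = ln 10 - 19 / 20 * ln 19"
  and deriv_entropy_E_9_10: "deriv entropy_E (9 / 10) = - (ln 19 / 2)"
proof -
  have l: "ln (19 / 10 :: real) = ln 19 - ln 10" "ln (1 / 10 :: real) = - ln 10"
    by (simp_all add: ln_div)
  show "entropy_E (9 / 10) = ln 10 - 19 / 20 * ln 19"
    unfolding entropy_E_def using l by (simp add: field_simps)
  show "deriv entropy_E (9 / 10) = - (ln 19 / 2)"
    using DERIV_imp_deriv[OF entropy_E_DERIV[of "9 / 10"]] l by simp
qed

text \<open>Apply \<open>ln y <= y - 1\<close> to \<open>y = 1 / sqrt x\<close>. The bound yields
  continuity of \<open>x * ln x\<close> at \<open>0\<close>.\<close>

lemma abs_x_ln_x_le: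
  fixes x :: real
  assumes "0 \<le> x" "x \<le> 1"
  shows "\<bar>x * ln x\<bar> \<le> 2 * sqrt x"
proof (cases "x = 0")
  case False
  then have x: "0 < x" using assms by simp
  have "ln (1 / sqrt x) \<le> 1 / sqrt x - 1" using x by (intro ln_le_minus_one) simp
  then have "- ln x \<le> 2 / sqrt x" using x by (simp add: ln_div ln_sqrt)
  then have "x * (- ln x) \<le> x * (2 / sqrt x)" using x by (intro mult_left_mono) auto
  also have "\<dots> = 2 * sqrt x" using x by (simp add: field_simps)
  finally show ?thesis using x assms by (simp add: abs_mult)
qed simp

lemma continuous_on_x_ln_x: "continuous_on {0::real..} (\<lambda>x. x * ln x)"
proof (rule continuous_on_eq_continuous_within[THEN iffD2], rule ballI)
  fix x :: real assume x: "x \<in> {0..}"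
  show "continuous (at x within {0..}) (\<lambda>x. x * ln x)"
  proof (cases "x = 0")
    case True
    have "((\<lambda>x::real. 2 * sqrt x) \<longlongrightarrow> 2 * sqrt 0) (at 0 within {0..})"
      by (intro tendsto_intros)
    then have lim: "((\<lambda>x::real. 2 * sqrt x) \<longlongrightarrow> 0) (at 0 within {0..})" by simp
    have "\<forall>\<^sub>F x in at (0::real) within {0..}. norm (x * ln x) \<le> 2 * sqrt x"
      unfolding eventually_at using abs_x_ln_x_le by (intro exI[of _ 1]) (auto simp: dist_real_def)
    from Lim_null_comparison[OF this lim] show ?thesis
      by (simp add: True continuous_within)
  next
    case False
    then have "isCont (\<lambda>x. x * ln x) x" using x by (intro continuous_intros) auto
    then show ?thesis by (rule continuous_at_imp_continuous_within)
  qed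
qed

lemma continuous_on_entropy_I: "continuous_on {0..1} entropy_I"
proof -
  have 1: "continuous_on {0..1} (\<lambda>a::real. a * ln a)"
    by (rule continuous_on_subset[OF continuous_on_x_ln_x]) auto
  have 2: "continuous_on {0..1} (\<lambda>a::real. (1 - a) * ln (1 - a))"
    by (rule continuous_on_compose2[OF continuous_on_x_ln_x]) (auto intro!: continuous_intros)
  have eq: "entropy_I = (\<lambda>a. - (a * ln a) - (1 - a) * ln (1 - a))"
    by (simp add: entropy_I_def fun_eq_iff)
  show ?thesis unfolding eq by (intro continuous_on_minus continuous_on_diff 1 2)
qed

lemma entropy_I_eq_entropy_E:
  assumes "0 \<le> a" "a \<le> 1"
  shows "entropy_I a = ln 2 + entropy_E (2 * a - 1)"
proof -
  have *: "x * ln (2 * x) = x * ln 2 + x * ln x" if "0 \<le> x" for x :: real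
    using that by (cases "x = 0") (simp_all add: ln_mult algebra_simps)
  have "entropy_E (2 * a - 1) = - (a * ln (2 * a)) - (1 - a) * ln (2 * (1 - a))"
  proof -
    have "1 + (2 * a - 1) = 2 * a" "1 - (2 * a - 1) = 2 * (1 - a)" by simp_all
    then show ?thesis unfolding entropy_E_def by simp
  qed
  also have "\<dots> = - ln 2 + entropy_I a"
    using *[of a] *[of "1 - a"] assms by (simp add: entropy_I_def algebra_simps)
  finally show ?thesis by simp
qed

text \<open>The factor of \<open>G''\<close> that carries its sign, since \<open>G'' t = t\<^sup>2 / (1 - t\<^sup>2) * curvature_poly \<beta> h t\<close>.\<close>

definition curvature_poly :: "real \<Rightarrow> real \<Rightarrow> real \<Rightarrow> real" where
  "curvature_poly \<beta> h t = (30 * \<beta> * t\<^sup>2 + 20 * h * t) * (1 - t\<^sup>2) - 1"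

text \<open>With \<open>t = 9 / 10\<close>, the first equation is
  \<open>5 * G t - t * G' t = 0\<close> solved for \<open>\<beta>\<close>, which eliminates
  \<open>h\<close>; the second is \<open>6 * G t - t * G' t = 0\<close> solved for \<open>h\<close>,
  which eliminates \<open>\<beta>\<close>.\<close>

locale six_spin_params =
  fixes \<beta> h :: real
  assumes \<beta>_eq: "\<beta> = (3 / 2 * (9 / 10)\<^sup>2 + 5 * entropy_E (9 / 10) - 9 / 10 * deriv entropy_E (9 / 10)) / (9 / 10) ^ 6"
    and h_eq: "h = (- 2 * (9 / 10)\<^sup>2 - 6 * entropy_E (9 / 10) + 9 / 10 * deriv entropy_E (9 / 10)) / (9 / 10) ^ 5"
begin

lemma \<beta>_bounds: "0.1255 \<le> \<beta>" "\<beta> \<le> 0.126"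
  and h_bounds: "0.038 \<le> h" "h \<le> 0.039"
  unfolding \<beta>_eq h_eq entropy_E_9_10 deriv_entropy_E_9_10
  using ln_10_bounds ln_19_bounds by (simp_all add: power_divide field_simps)

definition G :: "real \<Rightarrow> real" where
  "G t = \<beta> * t ^ 6 + h * t ^ 5 + t\<^sup>2 / 2 + entropy_E t"

definition G' :: "real \<Rightarrow> real" where
  "G' t = 6 * \<beta> * t ^ 5 + 5 * h * t ^ 4 + t + (ln (1 - t) - ln (1 + t)) / 2"

lemma six_spin_eq_G:
  assumes "0 \<le> a" "a \<le> 1"
  shows "six_spin \<beta> h a + entropy_I a = ln 2 + G (2 * a - 1)"
  using entropy_I_eq_entropy_E[OF assms] by (simp add: six_spin_def G_def)

text \<open>Differentiability gives this only inside the interval; the end points come from the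
  continuity of \<open>entropy_I\<close> on \<open>{0..1}\<close>.\<close>

lemma continuous_on_G: "continuous_on {- 1..1} G"
proof -
  have "continuous_on {- 1..1} (\<lambda>t. ln 2 + G t)"
  proof (rule continuous_on_eq)
    show "continuous_on {- 1..1} (\<lambda>t::real. six_spin \<beta> h ((1 + t) / 2) + entropy_I ((1 + t) / 2))"
      unfolding six_spin_def
      by (intro continuous_intros continuous_on_compose2[OF continuous_on_entropy_I]) auto
    show "six_spin \<beta> h ((1 + t) / 2) + entropy_I ((1 + t) / 2) = ln 2 + G t" if "t \<in> {- 1..1}" for t
    proof -
      have "2 * ((1 + t) / 2) - 1 = t" by (simp add: field_simps)
      with six_spin_eq_G[of "(1 + t) / 2"] that show ?thesis by (simp only:) simp
    qed
  qed
  from continuous_on_diff[OF this continuous_on_const[of _ "ln 2"]] show ?thesis by simp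
qed

lemma G_DERIV:
  assumes "- 1 < t" "t < 1"
  shows "(G has_real_derivative G' t) (at t)"
  unfolding G_def[abs_def] G'_def
  by (rule derivative_eq_intros entropy_E_DERIV[OF assms] refl | simp)+

text \<open>The \<open>1\<close> stemming from \<open>t^2 / 2\<close> combines with
  \<open>- 1 / (1 - t^2)\<close> to \<open>- t^2 / (1 - t^2)\<close>, so \<open>t^2\<close> factors
  out of the whole second derivative.\<close>

lemma G'_DERIV:
  assumes "- 1 < t" "t < 1"
  shows "(G' has_real_derivative t\<^sup>2 / (1 - t\<^sup>2) * curvature_poly \<beta> h t) (at t)"
proof -
  have "(1 - t) * (1 + t) > 0" using assms by (intro mult_pos_pos) auto
  then have "1 - t\<^sup>2 \<noteq> 0" by (simp add: power2_eq_square algebra_simps)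
  have "(G' has_real_derivative 30 * \<beta> * t ^ 4 + 20 * h * t ^ 3 + 1 + (- (1 / (1 - t)) - 1 / (1 + t)) / 2) (at t)"
    unfolding G'_def[abs_def] using assms by (auto intro!: derivative_eq_intros)
  also have "(- (1 / (1 - t)) - 1 / (1 + t)) / 2 = - 1 / (1 - t\<^sup>2)"
    using assms \<open>1 - t\<^sup>2 \<noteq> 0\<close> by (simp add: divide_simps) (simp add: power2_eq_square algebra_simps)
  also have "30 * \<beta> * t ^ 4 + 20 * h * t ^ 3 + 1 + - 1 / (1 - t\<^sup>2) = t\<^sup>2 / (1 - t\<^sup>2) * curvature_poly \<beta> h t"
    using \<open>1 - t\<^sup>2 \<noteq> 0\<close> by (simp add: curvature_poly_def divide_simps) (simp add: eval_nat_numeral algebra_simps)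
  finally show ?thesis .
qed

lemma G_0: "G 0 = 0" "G' 0 = 0"
  by (simp_all add: G_def G'_def entropy_E_def)

lemma G_9_10: "G (9 / 10) = 0" "G' (9 / 10) = 0"
proof -
  have l: "ln (19 / 10 :: real) = ln 19 - ln 10" "ln (1 / 10 :: real) = - ln 10"
    by (simp_all add: ln_div)
  show "G (9 / 10) = 0" "G' (9 / 10) = 0"
    unfolding G_def G'_def unfolding \<beta>_eq h_eq deriv_entropy_E_9_10 entropy_E_9_10
    using l by (simp_all add: power_divide field_simps)
qed

section \<open>Signs of the curvature polynomial\<close>

lemma curvature_poly_diff:
  "curvature_poly \<beta> h y - curvature_poly \<beta> h x
    = (y - x) * (20 * h * (1 - (x\<^sup>2 + x * y + y\<^sup>2)) + 30 * \<beta> * ((x + y) * (1 - (x\<^sup>2 + y\<^sup>2))))"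
  by (simp add: curvature_poly_def power2_eq_square algebra_simps)

text \<open>In the factored difference, \<open>1 - (x^2 + y^2)\<close> stays positive for arguments
  below \<open>1 / sqrt 2\<close>; the bound \<open>0.65\<close> leaves a margin. The
  \<open>h\<close>-part may be negative but is outweighed by the
  \<open>\<beta>\<close>-part.\<close>

lemma curvature_poly_increasing:
  assumes "0 \<le> x" "x < y" "y \<le> 0.65"
  shows "curvature_poly \<beta> h x < curvature_poly \<beta> h y"
proof -
  define s where "s = x + y"
  have s: "0 < s" "s \<le> 1.3" using assms by (auto simp: s_def)
  have xx: "x\<^sup>2 \<le> 0.65\<^sup>2" "y\<^sup>2 \<le> 0.65\<^sup>2" using assms by (intro power_mono; simp)+
  then have "0.155 \<le> 1 - (x\<^sup>2 + y\<^sup>2)" by (simp add: power2_eq_square)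
  then have "s * 0.155 \<le> s * (1 - (x\<^sup>2 + y\<^sup>2))" using s by (intro mult_left_mono) auto
  then have "30 * 0.1255 * (s * 0.155) \<le> 30 * \<beta> * (s * (1 - (x\<^sup>2 + y\<^sup>2)))"
    using \<beta>_bounds s by (intro mult_mono) auto
  then have 1: "0.58 * s \<le> 30 * \<beta> * (s * (1 - (x\<^sup>2 + y\<^sup>2)))" using s by simp
  have "x\<^sup>2 + x * y + y\<^sup>2 \<le> s\<^sup>2" using assms by (simp add: s_def power2_eq_square algebra_simps)
  moreover have "s\<^sup>2 \<le> 1.3 * s" using s by (simp add: power2_eq_square)
  ultimately have "1 - 1.3 * s \<le> 1 - (x\<^sup>2 + x * y + y\<^sup>2)" by simp
  then have 2: "20 * h * (1 - 1.3 * s) \<le> 20 * h * (1 - (x\<^sup>2 + x * y + y\<^sup>2))"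
    using h_bounds by (intro mult_left_mono) auto
  \<comment> \<open>In the second case the sum is at least \<open>0.78 - 0.434 * s\<close>, which is
    positive for \<open>s <= 1.3\<close>.\<close>
  have "0 < 20 * h * (1 - 1.3 * s) + 0.58 * s"
  proof (cases "1.3 * s \<le> 1")
    case True
    then show ?thesis using h_bounds s by (intro add_nonneg_pos) auto
  next
    case False
    then have "20 * 0.039 * (1 - 1.3 * s) \<le> 20 * h * (1 - 1.3 * s)"
      using h_bounds by (intro mult_right_mono_neg) auto
    then show ?thesis using s by simp
  qed
  then have "0 < 20 * h * (1 - (x\<^sup>2 + x * y + y\<^sup>2)) + 30 * \<beta> * ((x + y) * (1 - (x\<^sup>2 + y\<^sup>2)))"
    unfolding s_def[symmetric] by (rule less_le_trans[OF _ add_mono[OF 2 1]])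
  then have "0 < curvature_poly \<beta> h y - curvature_poly \<beta> h x"
    unfolding curvature_poly_diff using assms by (intro mult_pos_pos) auto
  then show ?thesis by simp
qed

text \<open>The bound \<open>0.71\<close> lies just above \<open>1 / sqrt 2\<close>, so
  \<open>1 - (x^2 + y^2)\<close> is negative and both parts of the factored difference have the same
  sign.\<close>

lemma curvature_poly_decreasing:
  assumes "0.71 \<le> x" "x < y"
  shows "curvature_poly \<beta> h y < curvature_poly \<beta> h x"
proof -
  have xx: "0.71\<^sup>2 \<le> x\<^sup>2" "0.71\<^sup>2 \<le> y\<^sup>2" using assms by (intro power_mono; simp)+
  then have 1: "1 - (x\<^sup>2 + y\<^sup>2) < 0" by (simp add: power2_eq_square)
  have "0 \<le> x * y" using assms by simp
  then have 2: "1 - (x\<^sup>2 + x * y + y\<^sup>2) < 0" using 1 by simp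
  have "20 * h * (1 - (x\<^sup>2 + x * y + y\<^sup>2)) < 0" "30 * \<beta> * ((x + y) * (1 - (x\<^sup>2 + y\<^sup>2))) < 0"
    using 1 2 h_bounds \<beta>_bounds assms by (auto intro!: mult_pos_neg)
  then have "curvature_poly \<beta> h y - curvature_poly \<beta> h x < 0"
    unfolding curvature_poly_diff using assms by (intro mult_pos_neg) auto
  then show ?thesis by simp
qed

text \<open>The gap between the two monotonicity ranges is so short that estimating each factor by
  its worst end point suffices; the margin is about \<open>0.03\<close>.\<close>

lemma curvature_poly_middle:
  assumes "0.65 \<le> x" "x \<le> 0.71"
  shows "0 < curvature_poly \<beta> h x"
proof -
  have xx: "0.65\<^sup>2 \<le> x\<^sup>2" "x\<^sup>2 \<le> 0.71\<^sup>2" using assms by (intro power_mono; simp)+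
  have "(30 * 0.1255 * 0.65\<^sup>2 + 20 * 0.038 * 0.65) * (1 - 0.71\<^sup>2) \<le> (30 * \<beta> * x\<^sup>2 + 20 * h * x) * (1 - x\<^sup>2)"
    using \<beta>_bounds h_bounds xx assms by (intro mult_mono add_mono) (auto simp: power2_eq_square)
  then show ?thesis by (simp add: curvature_poly_def power2_eq_square)
qed

lemma curvature_poly_9_10: "curvature_poly \<beta> h (9 / 10) < 0"
  using \<beta>_bounds h_bounds by (simp add: curvature_poly_def power2_eq_square)

lemma curvature_poly_signs:
  obtains u v where "0 < u" "u < v" "v < 9 / 10"
    "\<forall>t. 0 < t \<and> t < u \<longrightarrow> curvature_poly \<beta> h t < 0"
    "\<forall>t. u \<le> t \<and> t \<le> v \<longrightarrow> 0 \<le> curvature_poly \<beta> h t"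
    "\<forall>t. v < t \<longrightarrow> curvature_poly \<beta> h t < 0"
proof -
  let ?P = "curvature_poly \<beta> h"
  have c: "isCont ?P t" for t unfolding curvature_poly_def[abs_def] by (intro continuous_intros)
  obtain u where u: "0 \<le> u" "u \<le> 0.65" "?P u = 0"
    using IVT[of ?P 0 0 "0.65"] c curvature_poly_middle[of "0.65"] by (auto simp: curvature_poly_def)
  obtain v where v: "0.71 \<le> v" "v \<le> 9 / 10" "?P v = 0"
    using IVT2[of ?P "9 / 10" 0 "0.71"] c curvature_poly_middle[of "0.71"] curvature_poly_9_10 by auto
  have "u \<noteq> 0" using u by (auto simp: curvature_poly_def)
  moreover have "v \<noteq> 9 / 10" using v(3) curvature_poly_9_10 by (metis less_irrefl)
  moreover have "?P t < 0" if "0 < t" "t < u" for t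
    using curvature_poly_increasing[of t u] that u by simp
  moreover have "0 \<le> ?P t" if "u \<le> t" "t \<le> v" for t
  proof -
    consider "t \<le> 0.65" | "0.65 \<le> t" "t \<le> 0.71" | "0.71 \<le> t" by linarith
    then show ?thesis
    proof cases
      case 1
      then show ?thesis using curvature_poly_increasing[of u t] that u by (cases "u = t") auto
    next
      case 2
      then show ?thesis using curvature_poly_middle[of t] by simp
    next
      case 3
      then show ?thesis using curvature_poly_decreasing[of t v] that v by (cases "v = t") auto
    qed
  qed
  moreover have "?P t < 0" if "v < t" for t
    using curvature_poly_decreasing[of v t] that v by simp
  ultimately show ?thesis using that[of u v] u v by auto
qed

text \<open>On \<open>(0, u)\<close> the derivative \<open>G'\<close> decreases from
  \<open>0\<close>, so \<open>G\<close> falls below \<open>0\<close>. On \<open>(v, 1)\<close> it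
  decreases through \<open>0\<close> at \<open>9 / 10\<close>, so \<open>G\<close> peaks there at
  height \<open>0\<close>. In between \<open>G\<close> is convex and stays below the larger of its
  end values, which are negative by the other two cases.\<close>

lemma G_neg_pos:
  assumes t: "0 < t" "t \<le> 1" "t \<noteq> 9 / 10"
  shows "G t < 0"
proof -
  obtain u v where uv: "0 < u" "u < v" "v < 9 / 10"
    and P: "\<forall>t. 0 < t \<and> t < u \<longrightarrow> curvature_poly \<beta> h t < 0"
    "\<forall>t. u \<le> t \<and> t \<le> v \<longrightarrow> 0 \<le> curvature_poly \<beta> h t"
    "\<forall>t. v < t \<longrightarrow> curvature_poly \<beta> h t < 0"
    by (rule curvature_poly_signs) (rule that)
  have sq: "0 < x\<^sup>2 / (1 - x\<^sup>2)" if "0 < x" "x < 1" for x :: real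
    using that by (simp add: abs_square_less_1)
  have cG: "continuous_on {x..y} G" if "0 \<le> x" "y \<le> 1" for x y
    using continuous_on_G that by (auto intro: continuous_on_subset)
  have cG': "continuous_on {x..y} G'" if "0 \<le> x" "y < 1" for x y
    using that by (intro continuous_at_imp_continuous_on ballI DERIV_isCont[OF G'_DERIV]) auto
  have dec: "G' y < G' x" if "0 \<le> x" "x < y" "y < 1" "\<And>z. x < z \<Longrightarrow> z < y \<Longrightarrow> curvature_poly \<beta> h z < 0" for x y
  proof (rule DERIV_neg_imp_decreasing_open[OF that(2)])
    fix z assume z: "x < z" "z < y"
    have "(G' has_real_derivative z\<^sup>2 / (1 - z\<^sup>2) * curvature_poly \<beta> h z) (at z)"
      using z that by (intro G'_DERIV) auto
    moreover have "z\<^sup>2 / (1 - z\<^sup>2) * curvature_poly \<beta> h z < 0"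
      using sq[of z] that(4)[OF z] z that by (intro mult_pos_neg) auto
    ultimately show "\<exists>D. (G' has_real_derivative D) (at z) \<and> D < 0" by blast
  qed (use cG' that in auto)
  have dec_G: "G y < G x" if "0 \<le> x" "x < y" "y \<le> 1" "\<And>z. x < z \<Longrightarrow> z < y \<Longrightarrow> G' z < 0" for x y
  proof (rule DERIV_neg_imp_decreasing_open[OF that(2)])
    fix z assume z: "x < z" "z < y"
    then show "\<exists>D. (G has_real_derivative D) (at z) \<and> D < 0"
      using G_DERIV[of z] that by auto
  qed (use cG that in auto)
  have inc_G: "G x < G y" if "0 \<le> x" "x < y" "y \<le> 1" "\<And>z. x < z \<Longrightarrow> z < y \<Longrightarrow> 0 < G' z" for x y
  proof (rule DERIV_pos_imp_increasing_open[OF that(2)])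
    fix z assume z: "x < z" "z < y"
    then show "\<exists>D. (G has_real_derivative D) (at z) \<and> 0 < D"
      using G_DERIV[of z] that by auto
  qed (use cG that in auto)
  have 1: "G x < 0" if "0 < x" "x \<le> u" for x
  proof -
    have "G' z < 0" if "0 < z" "z < x" for z
      using dec[of 0 z] G_0 P(1) that \<open>x \<le> u\<close> uv by auto
    then show ?thesis using dec_G[of 0 x] G_0 that uv by auto
  qed
  have 2: "G x < 0" if "v \<le> x" "x < 9 / 10" for x
  proof -
    have "0 < G' z" if "x < z" "z < 9 / 10" for z
      using dec[of z "9 / 10"] G_9_10 P(3) that \<open>v \<le> x\<close> uv by auto
    then show ?thesis using inc_G[of x "9 / 10"] G_9_10 that uv by auto
  qed
  have 3: "G x < 0" if "9 / 10 < x" "x \<le> 1" for x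
  proof -
    have "G' z < 0" if "9 / 10 < z" "z < x" for z
      using dec[of "9 / 10" z] G_9_10 P(3) that \<open>x \<le> 1\<close> uv by auto
    then show ?thesis using dec_G[of "9 / 10" x] G_9_10 that uv by auto
  qed
  have 4: "G x < 0" if x: "u \<le> x" "x \<le> v" for x
  proof -
    have "convex_on {u..v} G"
    proof (rule f''_ge0_imp_convex)
      fix z assume "z \<in> {u..v}"
      then have z: "0 < z" "z < 1" "u \<le> z" "z \<le> v" using uv by auto
      show "(G has_real_derivative G' z) (at z)"
        using z by (intro G_DERIV) auto
      show "(G' has_real_derivative z\<^sup>2 / (1 - z\<^sup>2) * curvature_poly \<beta> h z) (at z)"
        using z by (intro G'_DERIV) auto
      show "0 \<le> z\<^sup>2 / (1 - z\<^sup>2) * curvature_poly \<beta> h z"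
        using sq[of z] z P(2) by (intro mult_nonneg_nonneg) auto
    qed simp
    then have "G x \<le> max (G u) (G v)" using x by (intro convex_on_le_max) auto
    also have "\<dots> < 0" using 1[of u] 2[of v] uv by simp
    finally show ?thesis .
  qed
  show ?thesis using 1[of t] 2[of t] 3[of t] 4[of t] t by linarith
qed

lemma entropy_E_uminus: "entropy_E (- t) = entropy_E t"
  by (simp add: entropy_E_def field_simps)

lemma G_neg:
  assumes "- 1 \<le> t" "t \<le> 1" "t \<noteq> 0" "t \<noteq> 9 / 10"
  shows "G t < 0"
proof (cases "0 < t")
  case True
  then show ?thesis using G_neg_pos assms by simp
next
  case False
  then have s: "0 < - t" "- t \<le> 1" using assms by auto
  \<comment> \<open>Equality occurs at \<open>t = - 9 / 10\<close>; strictness then comes from the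
    odd term \<open>h * t ^ 5\<close>.\<close>
  have "G (- t) \<le> 0"
  proof (cases "- t = 9 / 10")
    case True
    show ?thesis unfolding True G_9_10 by simp
  next
    case False
    then show ?thesis using G_neg_pos[OF s] by simp
  qed
  moreover have "G t = G (- t) - 2 * h * (- t) ^ 5"
    by (simp add: G_def entropy_E_uminus)
  moreover have "0 < 2 * h * (- t) ^ 5" using h_bounds s by (intro mult_pos_pos zero_less_power) auto
  ultimately show ?thesis by linarith
qed

lemma six_spin_max:
  assumes "0 \<le> a" "a \<le> 1"
  shows "six_spin \<beta> h a + entropy_I a \<le> ln 2"
    and "six_spin \<beta> h a + entropy_I a = ln 2 \<longleftrightarrow> a = 1 / 2 \<or> a = 95 / 100"
proof -
  define t where "t = 2 * a - 1"
  have t: "- 1 \<le> t" "t \<le> 1" and a: "t = 0 \<longleftrightarrow> a = 1 / 2" "t = 9 / 10 \<longleftrightarrow> a = 95 / 100"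
    using assms by (auto simp: t_def)
  have *: "G t \<le> 0 \<and> (G t = 0 \<longleftrightarrow> t = 0 \<or> t = 9 / 10)"
  proof (cases "t = 0 \<or> t = 9 / 10")
    case True
    then show ?thesis using G_0(1) G_9_10(1) by (elim disjE) (simp_all only: order_refl simp_thms)
  next
    case False
    then show ?thesis using G_neg[OF t] by auto
  qed
  then show "six_spin \<beta> h a + entropy_I a \<le> ln 2"
    "six_spin \<beta> h a + entropy_I a = ln 2 \<longleftrightarrow> a = 1 / 2 \<or> a = 95 / 100"
    unfolding six_spin_eq_G[OF assms] t_def[symmetric] a[symmetric] by linarith+
qed

lemma maximizers_six_spin:
  "maximizers (\<lambda>a. six_spin \<beta> h a + entropy_I a) = {1 / 2, 95 / 100}"
proof -
  let ?A = "\<lambda>a. six_spin \<beta> h a + entropy_I a"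
  have half: "?A (1 / 2) = ln 2" using six_spin_max(2)[of "1 / 2"] by simp
  show ?thesis
  proof (intro set_eqI iffI)
    fix a assume "a \<in> maximizers ?A"
    then have a: "0 \<le> a" "a \<le> 1" "?A (1 / 2) \<le> ?A a" by (simp_all add: maximizers_def)
    then have "?A a = ln 2" using six_spin_max(1)[of a] half by linarith
    then show "a \<in> {1 / 2, 95 / 100}" using six_spin_max(2)[OF a(1,2)] by blast
  next
    fix a :: real assume a: "a \<in> {1 / 2, 95 / 100}"
    then have a01: "0 \<le> a" "a \<le> 1" by auto
    moreover have "?A a = ln 2" using six_spin_max(2)[OF a01] a by blast
    ultimately show "a \<in> maximizers ?A" using six_spin_max(1) by (simp add: maximizers_def)
  qed
qed

end

section \<open>Derivatives and regularity of the maximizers\<close>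

text \<open>A derivative depends only on values nearby, so formulas valid on an open set can be
  differentiated repeatedly there, whatever \<open>D 0\<close> does elsewhere.\<close>

lemma higher_deriv_eq:
  fixes D :: "nat \<Rightarrow> real \<Rightarrow> real"
  assumes S: "open S" and D: "\<And>k x. x \<in> S \<Longrightarrow> (D k has_real_derivative D (Suc k) x) (at x)"
    and x: "x \<in> S"
  shows "(deriv ^^ k) (D 0) x = D k x"
  using x
proof (induction k arbitrary: x)
  case (Suc k)
  have "((deriv ^^ k) (D 0) has_real_derivative D (Suc k) x) (at x)"
    by (rule has_field_derivative_transform_within_open[OF D[OF Suc.prems] S Suc.prems])
      (simp add: Suc.IH)
  then show ?case by (simp add: DERIV_imp_deriv)
qed simp

text \<open>Lagrange's remainder with the intermediate terms zero; its factorial is estimated by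
  \<open>1\<close>.\<close>

lemma taylor_leading_term:
  fixes D :: "nat \<Rightarrow> real \<Rightarrow> real"
  assumes N: "1 \<le> N" and r: "\<bar>x - a\<bar> \<le> r"
    and D: "\<And>k y. \<bar>y - a\<bar> \<le> r \<Longrightarrow> (D k has_real_derivative D (Suc k) y) (at y)"
    and zero: "\<And>k. 1 \<le> k \<Longrightarrow> k < N \<Longrightarrow> D k a = 0"
    and M: "\<And>y. \<bar>y - a\<bar> \<le> r \<Longrightarrow> \<bar>D (Suc N) y\<bar> \<le> M"
  shows "\<bar>D 0 x - D 0 a - D N a / fact N * (x - a) ^ N\<bar> \<le> M * \<bar>x - a\<bar> ^ (N + 1)"
proof (cases "x = a")
  case True
  then show ?thesis using N by (simp add: power_0_left)
next
  case False
  have "\<exists>t. (if x < a then x < t \<and> t < a else a < t \<and> t < x) \<and>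
    D 0 x = (\<Sum>k<Suc N. (D k a / fact k) * (x - a) ^ k) + (D (Suc N) t / fact (Suc N)) * (x - a) ^ Suc N"
    using r False D by (intro Taylor[of _ _ _ "a - r" "a + r"]) (auto simp: abs_le_iff)
  then obtain t where t: "if x < a then x < t \<and> t < a else a < t \<and> t < x"
    and eq: "D 0 x = (\<Sum>k<Suc N. (D k a / fact k) * (x - a) ^ k) + (D (Suc N) t / fact (Suc N)) * (x - a) ^ Suc N"
    by blast
  have tr: "\<bar>t - a\<bar> \<le> r" using t r by (auto split: if_splits)
  have "(\<Sum>k<N. (D k a / fact k) * (x - a) ^ k) = (\<Sum>k\<in>{0}. (D k a / fact k) * (x - a) ^ k)"
    using N zero by (intro sum.mono_neutral_right) auto
  then have "D 0 x - D 0 a - D N a / fact N * (x - a) ^ N = (D (Suc N) t / fact (Suc N)) * (x - a) ^ Suc N"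
    unfolding eq by simp
  also have "\<bar>\<dots>\<bar> = \<bar>D (Suc N) t\<bar> / fact (Suc N) * \<bar>x - a\<bar> ^ Suc N"
    by (simp add: abs_mult power_abs del: fact_Suc power_Suc)
  also have "\<dots> \<le> M / 1 * \<bar>x - a\<bar> ^ Suc N"
    using M[OF tr] fact_ge_1[of "Suc N", where 'a = real]
    by (intro mult_right_mono frac_le) auto
  finally show ?thesis by simp
qed

text \<open>A single \<open>K\<close>, a bound for the derivative of order \<open>2 * m + 1\<close>
  near \<open>a\<close>, serves all small radii; then \<open>K * d <= c / 2\<close> is only a
  smallness condition on \<open>d\<close>.\<close>

lemma laplace_point_of_derivs:
  fixes D :: "nat \<Rightarrow> real \<Rightarrow> real"
  assumes m: "1 \<le> m" and a: "0 < a" "a < 1"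
    and D0: "D 0 = (\<lambda>x. f x + entropy_I x)"
    and D: "\<And>k x. 0 < x \<Longrightarrow> x < 1 \<Longrightarrow> (D k has_real_derivative D (Suc k) x) (at x)"
    and zero: "\<And>k. 1 \<le> k \<Longrightarrow> k < 2 * m \<Longrightarrow> D k a = 0" and neg: "D (2 * m) a < 0"
  obtains \<delta> K where "0 < \<delta>"
    "\<forall>d. 0 < d \<and> d < \<delta> \<longrightarrow> laplace_point f a (- D (2 * m) a / fact (2 * m)) K d m"
proof -
  \<comment> \<open>Half the distance to the boundary, so that the closed interval around
    \<open>a\<close> avoids the singularities at \<open>0\<close> and \<open>1\<close>.\<close>
  define r where "r = min a (1 - a) / 2"
  have r: "0 < r" "r < a" "r < 1 - a" using a by (auto simp: r_def min_def field_simps)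
  define c where "c = - D (2 * m) a / fact (2 * m)"
  have c: "0 < c" unfolding c_def using neg by (intro divide_pos_pos) auto
  have "continuous_on {a - r..a + r} (D (Suc (2 * m)))"
    using r by (intro continuous_at_imp_continuous_on ballI DERIV_isCont[OF D]) auto
  then have "bounded (D (Suc (2 * m)) ` {a - r..a + r})"
    by (intro compact_imp_bounded compact_continuous_image) auto
  then obtain M where M: "0 < M" "\<And>y. y \<in> {a - r..a + r} \<Longrightarrow> \<bar>D (Suc (2 * m)) y\<bar> \<le> M"
    unfolding bounded_pos by auto
  define \<delta> where "\<delta> = min r (c / (2 * M))"
  have "0 < \<delta>" using r c M by (simp add: \<delta>_def)
  moreover have "laplace_point f a c M d m" if d: "0 < d" "d < \<delta>" for d
  proof
    show "M * d \<le> c / 2" using d M by (simp add: \<delta>_def field_simps)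
    fix x :: real assume x: "\<bar>x - a\<bar> \<le> d"
    have "\<bar>D 0 x - D 0 a - D (2 * m) a / fact (2 * m) * (x - a) ^ (2 * m)\<bar> \<le> M * \<bar>x - a\<bar> ^ (2 * m + 1)"
    proof (rule taylor_leading_term[where r = r])
      show "\<bar>x - a\<bar> \<le> r" using x d by (simp add: \<delta>_def)
      show "(D k has_real_derivative D (Suc k) y) (at y)" if "\<bar>y - a\<bar> \<le> r" for k y
        using that r by (intro D) (auto simp: abs_le_iff)
      show "\<bar>D (Suc (2 * m)) y\<bar> \<le> M" if "\<bar>y - a\<bar> \<le> r" for y
        using that by (intro M(2)) (auto simp: abs_le_iff)
    qed (use m zero in auto)
    then show "\<bar>(f x + entropy_I x) - (f a + entropy_I a) + c * (x - a) ^ (2 * m)\<bar> \<le> M * \<bar>x - a\<bar> ^ (2 * m + 1)"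
      by (simp add: D0 c_def)
  qed (use m d r c M in \<open>auto simp: \<delta>_def\<close>)
  ultimately show ?thesis using that[of \<delta> M] unfolding c_def by blast
qed

text \<open>For \<open>k > N\<close> the product contains the factor \<open>0\<close>, which makes
  the truncated exponent \<open>N - k\<close> harmless.\<close>

definition shifted_power_deriv :: "nat \<Rightarrow> nat \<Rightarrow> real \<Rightarrow> real" where
  "shifted_power_deriv N k a = (\<Prod>i<k. real N - real i) * 2 ^ k * (2 * a - 1) ^ (N - k)"

text \<open>The uniform formula starts with the second derivative, where the logarithms have become
  reciprocals.\<close>

definition entropy_I_deriv :: "nat \<Rightarrow> real \<Rightarrow> real" where
  "entropy_I_deriv k a = (if k = 0 then entropy_I a else if k = 1 then ln (1 - a) - ln a
    else - fact (k - 2) * ((- 1) ^ k / a ^ (k - 1) + 1 / (1 - a) ^ (k - 1)))"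

definition six_spin_free_energy_deriv :: "real \<Rightarrow> real \<Rightarrow> nat \<Rightarrow> real \<Rightarrow> real" where
  "six_spin_free_energy_deriv \<beta> h k a = \<beta> * shifted_power_deriv 6 k a + h * shifted_power_deriv 5 k a
    + shifted_power_deriv 2 k a / 2 + entropy_I_deriv k a"

lemma shifted_power_deriv_DERIV:
  "(shifted_power_deriv N k has_real_derivative shifted_power_deriv N (Suc k) a) (at a)"
proof -
  have *: "((\<lambda>a. C * (2 * a - 1) ^ n) has_real_derivative C * (real n * (2 * a - 1) ^ (n - 1) * 2)) (at a)" for C :: real and n
    by (auto intro!: derivative_eq_intros)
  show ?thesis
  proof (cases "k < N")
    case True
    then have eq: "real N - real k = real (N - k)" "N - Suc k = N - k - 1" by auto
    have "shifted_power_deriv N (Suc k) a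
      = ((\<Prod>i<k. real N - real i) * 2 ^ k) * (real (N - k) * (2 * a - 1) ^ (N - k - 1) * 2)"
      unfolding shifted_power_deriv_def prod.lessThan_Suc power_Suc eq by (simp only: mult_ac)
    then show ?thesis unfolding shifted_power_deriv_def[of N k, abs_def] by (simp only: *)
  next
    case False
    then have "(\<Prod>i<Suc k. real N - real i) = 0" by (intro prod_zero) (auto intro!: bexI[of _ N])
    then have "shifted_power_deriv N (Suc k) a = 0" unfolding shifted_power_deriv_def by simp
    moreover have "shifted_power_deriv N k = (\<lambda>a. (\<Prod>i<k. real N - real i) * 2 ^ k)"
      using False by (simp add: shifted_power_deriv_def fun_eq_iff)
    ultimately show ?thesis by simp
  qed
qed

lemma inverse_power_DERIV:
  fixes x :: real
  assumes "x \<noteq> 0"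
  shows "((\<lambda>x. 1 / x ^ n) has_real_derivative - real n / x ^ Suc n) (at x)"
proof (cases n)
  case (Suc j)
  have "((\<lambda>x. 1 / x ^ n) has_real_derivative - (real n * x ^ (n - 1)) / (x ^ n * x ^ n)) (at x)"
    using assms by (auto intro!: derivative_eq_intros)
  also have "- (real n * x ^ (n - 1)) / (x ^ n * x ^ n) = - real n / x ^ Suc n"
    using assms by (simp add: Suc field_simps)
  finally show ?thesis .
qed simp

lemma entropy_I_deriv_DERIV:
  assumes "0 < a" "a < 1"
  shows "(entropy_I_deriv k has_real_derivative entropy_I_deriv (Suc k) a) (at a)"
proof -
  consider "k = 0" | "k = 1" | j where "k = Suc (Suc j)" by (metis One_nat_def nat.exhaust)
  then show ?thesis
  proof cases
    case 1
    have "((\<lambda>a. a * ln a) has_real_derivative ln a + 1) (at a)"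
      "((\<lambda>a. (1 - a) * ln (1 - a)) has_real_derivative - ln (1 - a) - 1) (at a)"
      using assms by (auto intro!: derivative_eq_intros)
    then have "((\<lambda>a. - (a * ln a) - (1 - a) * ln (1 - a)) has_real_derivative - (ln a + 1) - (- ln (1 - a) - 1)) (at a)"
      by (intro DERIV_diff DERIV_minus)
    then show ?thesis by (simp add: 1 entropy_I_deriv_def[abs_def] entropy_I_def)
  next
    case 2
    have "((\<lambda>a. ln (1 - a) - ln a) has_real_derivative - (1 / (1 - a)) - 1 / a) (at a)"
      using assms by (auto intro!: derivative_eq_intros)
    then have "((\<lambda>a. ln (1 - a) - ln a) has_real_derivative - (1 / a) - 1 / (1 - a)) (at a)"
      by (rule DERIV_cong) simp
    then show ?thesis by (simp add: 2 entropy_I_deriv_def[abs_def])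
  next
    case 3
    have "((\<lambda>a. 1 / (1 - a) ^ Suc j) has_real_derivative - real (Suc j) / (1 - a) ^ Suc (Suc j) * (- 1)) (at a)"
      using assms by (intro DERIV_chain2[OF inverse_power_DERIV]) (auto intro!: derivative_eq_intros)
    moreover have "((\<lambda>a. 1 / a ^ Suc j) has_real_derivative - real (Suc j) / a ^ Suc (Suc j)) (at a)"
      using assms by (intro inverse_power_DERIV) auto
    ultimately have "((\<lambda>a. - fact j * ((- 1) ^ k * (1 / a ^ Suc j) + 1 / (1 - a) ^ Suc j)) has_real_derivative
      - fact j * ((- 1) ^ k * (- real (Suc j) / a ^ Suc (Suc j)) + - real (Suc j) / (1 - a) ^ Suc (Suc j) * (- 1))) (at a)"
      by (intro DERIV_cmult DERIV_add)
    moreover have "- fact j * ((- 1) ^ k * (- real (Suc j) / a ^ Suc (Suc j)) + - real (Suc j) / (1 - a) ^ Suc (Suc j) * (- 1))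
      = entropy_I_deriv (Suc k) a"
      by (simp add: 3 entropy_I_deriv_def algebra_simps add_divide_distrib diff_divide_distrib)
    moreover have "(\<lambda>a. - fact j * ((- 1) ^ k * (1 / a ^ Suc j) + 1 / (1 - a) ^ Suc j)) = entropy_I_deriv k"
      by (simp add: 3 entropy_I_deriv_def fun_eq_iff)
    ultimately show ?thesis by simp
  qed
qed

lemma six_spin_free_energy_deriv_DERIV:
  assumes "0 < a" "a < 1"
  shows "(six_spin_free_energy_deriv \<beta> h k has_real_derivative six_spin_free_energy_deriv \<beta> h (Suc k) a) (at a)"
  unfolding six_spin_free_energy_deriv_def[abs_def]
  by (intro DERIV_add DERIV_cmult DERIV_cdivide shifted_power_deriv_DERIV entropy_I_deriv_DERIV assms)

lemma six_spin_free_energy_deriv_0: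
  "six_spin_free_energy_deriv \<beta> h 0 = (\<lambda>a. six_spin \<beta> h a + entropy_I a)"
  by (simp add: six_spin_free_energy_deriv_def[abs_def] shifted_power_deriv_def entropy_I_deriv_def six_spin_def)

lemma deriv_six_spin_free_energy:
  assumes "0 < a" "a < 1"
  shows "(deriv ^^ k) (\<lambda>a. six_spin \<beta> h a + entropy_I a) a = six_spin_free_energy_deriv \<beta> h k a"
  using higher_deriv_eq[of "{0<..<1}" "six_spin_free_energy_deriv \<beta> h" a k] six_spin_free_energy_deriv_DERIV assms
  by (simp add: six_spin_free_energy_deriv_0)

text \<open>At \<open>1 / 2\<close> the base \<open>2 * a - 1\<close> is zero, so a power
  contributes only to the derivative of its own order. At order two this gives \<open>4 - 4\<close>;
  the third entropy derivative vanishes by symmetry; at order four only the entropy remains, with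
  \<open>- 2 * (8 + 8)\<close>.\<close>

lemma six_spin_free_energy_deriv_half:
  "six_spin_free_energy_deriv \<beta> h (Suc 0) (1 / 2) = 0"
  "six_spin_free_energy_deriv \<beta> h 2 (1 / 2) = 0"
  "six_spin_free_energy_deriv \<beta> h 3 (1 / 2) = 0"
  "six_spin_free_energy_deriv \<beta> h 4 (1 / 2) = - 32"
  by (simp_all add: six_spin_free_energy_deriv_def shifted_power_deriv_def entropy_I_deriv_def eval_nat_numeral)

context six_spin_params
begin

text \<open>The first derivative is \<open>2 * G' (9 / 10)\<close> by the substitution
  \<open>t = 2 * a - 1\<close>; the sign of the second follows from the numerical bounds on
  \<open>\<beta>\<close> and \<open>h\<close>.\<close>

lemma six_spin_free_energy_deriv_95:
  "six_spin_free_energy_deriv \<beta> h (Suc 0) (95 / 100) = 0"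
  "six_spin_free_energy_deriv \<beta> h 2 (95 / 100) < 0"
proof -
  have "ln (95 / 100 :: real) - ln (5 / 100) = ln (19 / 10) - ln (1 / 10)"
    by (simp add: ln_div)
  then have "six_spin_free_energy_deriv \<beta> h (Suc 0) (95 / 100) = 2 * G' (9 / 10)"
    by (simp add: six_spin_free_energy_deriv_def shifted_power_deriv_def entropy_I_deriv_def G'_def eval_nat_numeral field_simps)
  then show "six_spin_free_energy_deriv \<beta> h (Suc 0) (95 / 100) = 0" using G_9_10 by simp
  show "six_spin_free_energy_deriv \<beta> h 2 (95 / 100) < 0"
    using \<beta>_bounds h_bounds
    by (simp add: six_spin_free_energy_deriv_def shifted_power_deriv_def entropy_I_deriv_def eval_nat_numeral)
qed

end

section \<open>Concentration and the limit theorem\<close>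

text \<open>The crude entropy bound is enough here: \<open>n + 1\<close> terms cannot compensate an
  exponential gap, and it applies to all \<open>k\<close>, boundary included.\<close>

lemma sum_away_from_maxima_le:
  assumes n: "1 \<le> n" and R: "R \<subseteq> {..n}" and b: "\<And>k. k \<in> R \<Longrightarrow> f (real k / real n) + entropy_I (real k / real n) \<le> b"
  shows "(\<Sum>k\<in>R. spin_weight f n k) \<le> real (n + 1) * exp (real n * b)"
proof -
  have "(\<Sum>k\<in>R. spin_weight f n k) \<le> (\<Sum>k\<in>R. exp (real n * b))"
  proof (rule sum_mono)
    fix k assume k: "k \<in> R"
    have "spin_weight f n k \<le> exp (real n * entropy_I (real k / real n)) * exp (real n * f (real k / real n))"
      unfolding spin_weight_def using binomial_le_exp_entropy[of k n] R k n by (intro mult_right_mono) auto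
    also have "\<dots> = exp (real n * (f (real k / real n) + entropy_I (real k / real n)))"
      by (simp add: exp_add[symmetric] algebra_simps)
    also have "\<dots> \<le> exp (real n * b)" using b[OF k] by (simp add: mult_left_mono)
    finally show "spin_weight f n k \<le> exp (real n * b)" .
  qed
  also have "\<dots> = real (card R) * exp (real n * b)" by simp
  also have "\<dots> \<le> real (n + 1) * exp (real n * b)"
    using card_mono[OF _ R] by (intro mult_right_mono) auto
  finally show ?thesis .
qed

text \<open>Away from \<open>a1\<close>, a value \<open>k / n\<close> lies either in the window of
  \<open>a2\<close>, whose mass is smaller by a negative power of \<open>n\<close>, or in a compact
  set on which the free energy is below its maximum by a fixed gap \<open>\<eta>\<close>.\<close>

lemma concentration_at_flatter_maximum:
  fixes f :: "real \<Rightarrow> real"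
  assumes L1: "laplace_point f a1 c1 K1 d m1" and L2: "laplace_point f a2 c2 K2 d m2" and m: "m2 < m1"
    and eq: "f a2 + entropy_I a2 = f a1 + entropy_I a1"
    and cont: "continuous_on {0..1} f"
    and max: "\<And>x. 0 \<le> x \<Longrightarrow> x \<le> 1 \<Longrightarrow> x \<noteq> a1 \<Longrightarrow> x \<noteq> a2 \<Longrightarrow> f x + entropy_I x < f a1 + entropy_I a1"
  shows "(\<lambda>n. measure (gibbs f n) {\<omega> \<in> configs n. frac_plus n \<omega> \<in> {x. d \<le> \<bar>x - a1\<bar>}}) \<longlonglongrightarrow> 0"
proof -
  interpret L1: laplace_point f a1 c1 K1 d m1 by fact
  interpret L2: laplace_point f a2 c2 K2 d m2 by fact
  define A where "A = f a1 + entropy_I a1"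
  \<comment> \<open>Open balls are removed, matching the strict inequality in \<open>window\<close>;
    what remains is compact and avoids both maximizers.\<close>
  define T where "T = {0..1} - (ball a1 d \<union> ball a2 d)"
  have "compact T" unfolding T_def by (intro compact_diff) auto
  have contT: "continuous_on T (\<lambda>x. f x + entropy_I x)"
    by (intro continuous_on_add continuous_on_subset[OF cont] continuous_on_subset[OF continuous_on_entropy_I])
      (auto simp: T_def)
  obtain \<eta> where \<eta>: "0 < \<eta>" "\<And>x. x \<in> T \<Longrightarrow> f x + entropy_I x \<le> A - \<eta>"
  proof (cases "T = {}")
    case True
    then show ?thesis using that[of 1] by simp
  next
    case False
    then obtain x where x: "x \<in> T" "\<And>y. y \<in> T \<Longrightarrow> f y + entropy_I y \<le> f x + entropy_I x"
      using continuous_attains_sup[OF \<open>compact T\<close> _ contT] by blast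
    have "f x + entropy_I x < A" unfolding A_def
      using x(1) L1.d L2.d by (intro max) (auto simp: T_def)
    then show ?thesis using that[of "A - (f x + entropy_I x)"] x(2) by simp
  qed
  define S1 where "S1 n = (\<Sum>k\<in>L1.window n. spin_weight f n k)" for n
  define S2 where "S2 n = (\<Sum>k\<in>L2.window n. spin_weight f n k)" for n
  define u1 where "u1 n = S1 n * exp (- (real n * A)) * sqrt (real n) * L1.mesh n" for n
  define u2 where "u2 n = S2 n * exp (- (real n * A)) * sqrt (real n) * L2.mesh n" for n
  obtain b1 where b1: "0 < b1" "u1 \<longlonglongrightarrow> b1"
    using L1.window_mass_asymp unfolding u1_def[abs_def] S1_def A_def by blast
  obtain b2 where b2: "u2 \<longlonglongrightarrow> b2"
    using L2.window_mass_asymp unfolding u2_def[abs_def] S2_def A_def eq by blast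
  define P where "P n = measure (gibbs f n) {\<omega> \<in> configs n. frac_plus n \<omega> \<in> {x. d \<le> \<bar>x - a1\<bar>}}" for n
  \<comment> \<open>The ratio of the two meshes; its exponent is negative because
    \<open>m2 < m1\<close>.\<close>
  define q where "q n = real n powr (- 1 / (2 * real m2) + 1 / (2 * real m1))" for n
  \<comment> \<open>This is \<open>4 * n^2 / exp (\<eta> * n)\<close> in a form fit for the limit of
    a power over the exponential; \<open>4 * n^2\<close> bounds
    \<open>(n + 1) * sqrt n * mesh\<close>.\<close>
  define e where "e n = 4 / \<eta>\<^sup>2 * ((\<eta> * real n) ^ 2 / exp (\<eta> * real n))" for n
  have "\<forall>\<^sub>F n in sequentially. 0 < u1 n" using b1 by (intro order_tendstoD)
  then have ev: "\<forall>\<^sub>F n in sequentially. P n \<le> (u2 n * q n + e n) / u1 n"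
    using eventually_ge_at_top[of 1]
  proof eventually_elim
    case (elim n)
    have n: "1 \<le> real n" using elim by simp
    define E where "E = exp (- (real n * A)) * sqrt (real n)"
    have E: "0 < E" using n by (simp add: E_def)
    define R where "R = {k. k \<le> n \<and> real k / real n \<in> T}"
    define F where "F = {k. k \<le> n \<and> real k / real n \<in> {x. d \<le> \<bar>x - a1\<bar>}}"
    have wpos: "0 \<le> spin_weight f n k" if "k \<le> n" for k using spin_weight_pos[OF that] by (rule less_imp_le)
    have finR: "finite R" unfolding R_def by (rule finite_subset[of _ "{..n}"]) auto
    have "F \<subseteq> L2.window n \<union> R"
    proof
      fix k assume k: "k \<in> F"
      have "0 \<le> real k / real n" "real k / real n \<le> 1" using n k by (auto simp: F_def)
      then show "k \<in> L2.window n \<union> R"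
        using k by (auto simp: F_def R_def T_def L2.window_def dist_real_def abs_minus_commute)
    qed
    then have "(\<Sum>k\<in>F. spin_weight f n k) \<le> (\<Sum>k\<in>L2.window n \<union> R. spin_weight f n k)"
      using finR wpos by (intro sum_mono2) (auto simp: R_def L2.window_def)
    also have "\<dots> \<le> S2 n + (\<Sum>k\<in>R. spin_weight f n k)"
      unfolding S2_def using finR wpos sum.union_inter[of "L2.window n" R "spin_weight f n"]
        sum_nonneg[of "L2.window n \<inter> R" "spin_weight f n"]
      by (auto simp: R_def)
    also have "(\<Sum>k\<in>R. spin_weight f n k) \<le> real (n + 1) * exp (real n * (A - \<eta>))"
      using elim \<eta> by (intro sum_away_from_maxima_le) (auto simp: R_def)
    finally have F: "(\<Sum>k\<in>F. spin_weight f n k) \<le> S2 n + real (n + 1) * exp (real n * (A - \<eta>))" by simp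
    have mesh: "L1.mesh n = L2.mesh n * q n"
    proof -
      have "L2.scale n = L1.scale n * q n"
        using n by (simp add: L1.scale_def L2.scale_def q_def powr_add[symmetric])
      moreover have "0 < q n" using n by (simp add: q_def)
      ultimately show ?thesis using L1.scale(1)[OF elim(2)] L2.scale(1)[OF elim(2)] n
        by (simp add: L1.mesh_def L2.mesh_def field_simps)
    qed
    have S1: "0 < S1 n" using elim(1) L1.mesh[OF elim(2)] E unfolding u1_def
      by (simp add: zero_less_mult_iff)
    have "S1 n \<le> (\<Sum>k\<le>n. spin_weight f n k)"
      unfolding S1_def using wpos by (intro sum_mono2) (auto simp: L1.window_def)
    then have "P n \<le> (\<Sum>k\<in>F. spin_weight f n k) / S1 n"
      unfolding P_def gibbs_prob F_def[symmetric] using S1 wpos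
      by (intro divide_left_mono sum_nonneg) (auto simp: F_def intro!: mult_pos_pos)
    also have "\<dots> \<le> (S2 n + real (n + 1) * exp (real n * (A - \<eta>))) / S1 n"
      using F S1 by (intro divide_right_mono) auto
    also have "\<dots> = (S2 n + real (n + 1) * exp (real n * (A - \<eta>))) * (E * L1.mesh n) / u1 n"
      using n S1 E L1.mesh[OF elim(2)] by (simp add: u1_def E_def)
    also have "\<dots> \<le> (u2 n * q n + e n) / u1 n"
    proof (intro divide_right_mono)
      have "real (n + 1) * exp (real n * (A - \<eta>)) * (E * L1.mesh n)
        = real (n + 1) * sqrt (real n) * L1.mesh n * (exp (real n * (A - \<eta>)) * exp (- (real n * A)))"
        by (simp add: E_def)
      also have "exp (real n * (A - \<eta>)) * exp (- (real n * A)) = 1 / exp (\<eta> * real n)"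
        by (simp add: exp_add[symmetric] exp_minus[symmetric] divide_inverse algebra_simps)
      also have "real (n + 1) * sqrt (real n) * L1.mesh n \<le> (2 * real n) * real n * 2"
        using n L1.mesh[OF elim(2)] by (intro mult_mono) (auto intro!: real_le_lsqrt simp: power2_eq_square mult_le_cancel_right1)
      then have "real (n + 1) * sqrt (real n) * L1.mesh n * (1 / exp (\<eta> * real n)) \<le> (2 * real n) * real n * 2 * (1 / exp (\<eta> * real n))"
        by (intro mult_right_mono) auto
      also have "\<dots> = e n" using \<eta> by (simp add: e_def power2_eq_square)
      finally have "real (n + 1) * exp (real n * (A - \<eta>)) * (E * L1.mesh n) \<le> e n" .
      moreover have "S2 n * (E * L1.mesh n) = u2 n * q n"
        unfolding mesh u2_def E_def by simp
      ultimately show "(S2 n + real (n + 1) * exp (real n * (A - \<eta>))) * (E * L1.mesh n) \<le> u2 n * q n + e n"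
        by (simp add: distrib_right)
    qed (use elim in auto)
    finally show ?case .
  qed
  have "(\<lambda>n. (u2 n * q n + e n) / u1 n) \<longlonglongrightarrow> (b2 * 0 + 4 / \<eta>\<^sup>2 * 0) / b1"
  proof (intro tendsto_intros b1 b2)
    have "- 1 / (2 * real m2) + 1 / (2 * real m1) < 0"
      using L1.m L2.m m by (simp add: field_simps)
    then show "q \<longlonglongrightarrow> 0" unfolding q_def by (intro tendsto_neg_powr filterlim_real_sequentially)
    have "filterlim (\<lambda>n. \<eta> * real n) at_top sequentially"
      using \<eta> by (intro filterlim_tendsto_pos_mult_at_top[OF tendsto_const] filterlim_real_sequentially) auto
    then have "(\<lambda>n. (\<eta> * real n) ^ 2 / exp (\<eta> * real n)) \<longlonglongrightarrow> 0"
      by (rule filterlim_compose[OF tendsto_power_div_exp_0])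
    then show "e \<longlonglongrightarrow> 4 / \<eta>\<^sup>2 * 0" unfolding e_def by (intro tendsto_intros)
  qed (use b1 in auto)
  then have lim: "(\<lambda>n. (u2 n * q n + e n) / u1 n) \<longlonglongrightarrow> 0" by simp
  have "P \<longlonglongrightarrow> 0"
    by (rule Lim_null_comparison[OF _ lim]) (use ev in \<open>simp add: P_def\<close>)
  then show ?thesis unfolding P_def .
qed

section \<open>Convergence in law and identification of the limits\<close>

lemma cdf_return_0: "cdf (return borel 0) x = (if 0 \<le> x then 1 else 0)"
  by (simp add: cdf_def measure_return)

text \<open>At a point \<open>x\<close> other than \<open>0\<close>, the distribution functions of
  \<open>M_n / n\<close> and of the point mass differ at most by the probability that
  \<open>frac_plus\<close> is at least \<open>|x| / 2\<close> away from
  \<open>1 / 2\<close>.\<close>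

lemma weak_conv_magnetization:
  assumes \<delta>: "0 < \<delta>" and P: "\<And>d. 0 < d \<Longrightarrow> d < \<delta> \<Longrightarrow>
    (\<lambda>n. measure (gibbs f n) {\<omega> \<in> configs n. frac_plus n \<omega> \<in> {x. d \<le> \<bar>x - 1 / 2\<bar>}}) \<longlonglongrightarrow> 0"
  shows "weak_conv_m (\<lambda>n. distr (gibbs f n) borel (\<lambda>\<omega>. magnetization n \<omega> / real n)) (return borel 0)"
  unfolding weak_conv_m_def weak_conv_def
proof (intro allI impI)
  fix x :: real assume x: "isCont (cdf (return borel 0)) x"
  have "x \<noteq> 0"
  proof
    assume "x = 0"
    \<comment> \<open>Approaching \<open>0\<close> from the left exposes the jump of the limit, so
      \<open>0\<close> is no continuity point.\<close>
    have "(\<lambda>n. - inverse (real (Suc n))) \<longlonglongrightarrow> - 0"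
      by (intro tendsto_minus LIMSEQ_inverse_real_of_nat)
    then have "(\<lambda>n. cdf (return borel 0) (- inverse (real (Suc n)))) \<longlonglongrightarrow> cdf (return borel 0) 0"
      using isCont_tendsto_compose[OF x[unfolded \<open>x = 0\<close>]] by simp
    moreover have "cdf (return borel 0) (- inverse (real (Suc n))) = 0" for n
      unfolding cdf_return_0 by (simp add: not_le)
    ultimately show False by (simp add: cdf_return_0 LIMSEQ_const_iff)
  qed
  \<comment> \<open>Half of \<open>|x|\<close>, since the magnetization per spin is twice the
    deviation of \<open>frac_plus\<close> from \<open>1 / 2\<close>.\<close>
  define d where "d = min (\<bar>x\<bar> / 2) (\<delta> / 2)"
  have d: "0 < d" "d < \<delta>" "d \<le> \<bar>x\<bar> / 2" using \<open>x \<noteq> 0\<close> \<delta> by (auto simp: d_def)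
  have "\<forall>\<^sub>F n in sequentially. norm (cdf (distr (gibbs f n) borel (\<lambda>\<omega>. magnetization n \<omega> / real n)) x - cdf (return borel 0) x)
    \<le> measure (gibbs f n) {\<omega> \<in> configs n. frac_plus n \<omega> \<in> {x. d \<le> \<bar>x - 1 / 2\<bar>}}"
    using eventually_ge_at_top[of 1]
  proof eventually_elim
    case (elim n)
    interpret prob_space "gibbs f n" by (rule prob_space_gibbs)
    have sp: "space (gibbs f n) = configs n" "sets (gibbs f n) = Pow (configs n)"
      by (simp_all add: gibbs_def space_point_measure sets_point_measure)
    have meas: "(\<lambda>\<omega>. magnetization n \<omega> / real n) \<in> measurable (gibbs f n) borel"
      by (auto simp: measurable_def sp)
    have mag: "magnetization n \<omega> / real n = 2 * (frac_plus n \<omega> - 1 / 2)" if "\<omega> \<in> configs n" for \<omega>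
      using magnetization_num_plus[OF that] elim by (simp add: frac_plus_num_plus field_simps)
    have cdf: "cdf (distr (gibbs f n) borel (\<lambda>\<omega>. magnetization n \<omega> / real n)) x = prob {\<omega> \<in> configs n. magnetization n \<omega> / real n \<le> x}"
      unfolding cdf_def using meas by (subst measure_distr) (auto simp: sp intro!: arg_cong[of _ _ prob])
    show ?case
    proof (cases "0 \<le> x")
      case False
      have "prob {\<omega> \<in> configs n. magnetization n \<omega> / real n \<le> x}
        \<le> prob {\<omega> \<in> configs n. frac_plus n \<omega> \<in> {x. d \<le> \<bar>x - 1 / 2\<bar>}}"
        using False d mag by (intro finite_measure_mono) (auto simp: sp)
      then show ?thesis using False by (simp add: cdf cdf_return_0)
    next
      case True
      have "1 - prob {\<omega> \<in> configs n. magnetization n \<omega> / real n \<le> x}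
        = prob (space (gibbs f n) - {\<omega> \<in> configs n. magnetization n \<omega> / real n \<le> x})"
        by (intro prob_compl[symmetric]) (auto simp: sp)
      also have "\<dots> \<le> prob {\<omega> \<in> configs n. frac_plus n \<omega> \<in> {x. d \<le> \<bar>x - 1 / 2\<bar>}}"
        using True d mag by (intro finite_measure_mono) (auto simp: sp)
      finally show ?thesis using True by (simp add: cdf cdf_return_0)
    qed
  qed
  from Lim_null_comparison[OF this P[OF d(1,2)]]
  show "(\<lambda>n. cdf (distr (gibbs f n) borel (\<lambda>\<omega>. magnetization n \<omega> / real n)) x) \<longlonglongrightarrow> cdf (return borel 0) x"
    by (rule LIM_zero_cancel)
qed

text \<open>For variance \<open>4 / |D|\<close> the exponent \<open>x^2 / (2 * variance)\<close>
  equals \<open>(|D| / 2) * (x / 2)^2\<close>. The normalizing integral is read off from the total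
  mass of the normal density.\<close>

lemma centered_normal_eq_quasi_gaussian:
  assumes "D < 0"
  shows "centered_normal (4 / \<bar>D\<bar>) = proportional_law (quasi_gaussian (- D / 2) 1)"
proof -
  define \<sigma> where "\<sigma> = sqrt (4 / \<bar>D\<bar>)"
  have \<sigma>: "0 < \<sigma>" "\<sigma>\<^sup>2 = 4 / \<bar>D\<bar>" using assms by (auto simp: \<sigma>_def)
  define s where "s = sqrt (2 * pi * \<sigma>\<^sup>2)"
  have s: "0 < s" unfolding s_def using \<sigma>(1)
    by (intro real_sqrt_gt_zero mult_pos_pos zero_less_power) auto
  have nd: "normal_density 0 \<sigma> x = quasi_gaussian (- D / 2) 1 x / s" for x
  proof -
    have "- (x - 0)\<^sup>2 / (2 * \<sigma>\<^sup>2) = - (- D / 2) * (x / 2) ^ (2 * 1)"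
      unfolding \<sigma>(2) using assms by (simp add: field_simps power2_eq_square)
    then show ?thesis unfolding normal_density_def quasi_gaussian_def s_def by simp
  qed
  have "1 = (\<integral>x. quasi_gaussian (- D / 2) 1 x / s \<partial>lborel)"
    unfolding nd[symmetric] using integral_normal_density[OF \<sigma>(1)] by simp
  then have "(\<integral>x. quasi_gaussian (- D / 2) 1 x \<partial>lborel) = s" using s by (simp add: field_simps)
  then show ?thesis unfolding centered_normal_def proportional_law_def \<sigma>_def[symmetric] nd by simp
qed

theorem theorem5p8:
  fixes t \<beta> h :: real and A :: "real \<Rightarrow> real"
  assumes t: "t = 9 / 10"
    and \<beta>: "\<beta> = (3 / 2 * t\<^sup>2 + 5 * entropy_E t - t * deriv entropy_E t) / t ^ 6"
    and h: "h = (- 2 * t\<^sup>2 - 6 * entropy_E t + t * deriv entropy_E t) / t ^ 5"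
    and A: "A = (\<lambda>a. six_spin \<beta> h a + entropy_I a)"
  shows "maximizers A = {1 / 2, 95 / 100}
    \<and> regular_maximizer A 2 (1 / 2)
    \<and> regular_maximizer A 1 (95 / 100)
    \<and> weak_conv_m
        (\<lambda>n. distr (gibbs (six_spin \<beta> h) n) borel (\<lambda>\<omega>. magnetization n \<omega> / real n))
        (return borel 0)
    \<and> (\<exists>\<delta>\<^sub>0>0. \<forall>\<delta>. 0 < \<delta> \<and> \<delta> < \<delta>\<^sub>0 \<longrightarrow>
        (\<exists>C. \<forall>\<^sub>F n in sequentially.
          wasserstein
            (cond_law (six_spin \<beta> h) n {1 / 2 - \<delta> <..< 1 / 2 + \<delta>}
              (\<lambda>\<omega>. real n powr (- 3 / 4) * magnetization n \<omega>))
            (proportional_law (\<lambda>x. exp ((deriv ^^ 4) A (1 / 2) * x ^ 4 / (2 ^ 4 * fact 4))))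
          \<le> ennreal (C * real n powr (- 1 / 4)))
      \<and> (\<exists>C. \<forall>\<^sub>F n in sequentially.
          wasserstein
            (cond_law (six_spin \<beta> h) n {95 / 100 - \<delta> <..< 95 / 100 + \<delta>}
              (\<lambda>\<omega>. (magnetization n \<omega> - 9 / 10 * real n) / sqrt (real n)))
            (centered_normal (4 / \<bar>(deriv ^^ 2) A (95 / 100)\<bar>))
          \<le> ennreal (C * real n powr (- 1 / 2))))"
proof -
  define D where "D = six_spin_free_energy_deriv \<beta> h"
  interpret six_spin_params \<beta> h
    using \<beta> h unfolding t by unfold_locales
  have D: "(deriv ^^ k) A a = D k a" if "0 < a" "a < 1" for k a
    unfolding A D_def by (rule deriv_six_spin_free_energy[OF that])
  have D_half: "D k (1 / 2) = 0" if "1 \<le> k" "k < 4" for k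
  proof -
    have "k = Suc 0 \<or> k = 2 \<or> k = 3" using that by auto
    then show ?thesis unfolding D_def using six_spin_free_energy_deriv_half by auto
  qed
  have D4: "D 4 (1 / 2) = - 32" unfolding D_def by (rule six_spin_free_energy_deriv_half)
  have D_95: "D k (95 / 100) = 0" if "1 \<le> k" "k < 2" for k
  proof -
    have "k = Suc 0" using that by auto
    then show ?thesis unfolding D_def using six_spin_free_energy_deriv_95 by simp
  qed
  have D2: "D 2 (95 / 100) < 0" unfolding D_def by (rule six_spin_free_energy_deriv_95)
  have max: "maximizers A = {1 / 2, 95 / 100}" unfolding A by (rule maximizers_six_spin)
  have reg1: "regular_maximizer A 2 (1 / 2)"
    unfolding regular_maximizer_def max using D D_half D4 by simp
  have reg2: "regular_maximizer A 1 (95 / 100)"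
    unfolding regular_maximizer_def max using D D_95 D2 by simp
  note laplace = laplace_point_of_derivs[of _ _ D "six_spin \<beta> h",
      OF _ _ _ six_spin_free_energy_deriv_0[where \<beta> = \<beta> and h = h, folded D_def]
        six_spin_free_energy_deriv_DERIV[where \<beta> = \<beta> and h = h, folded D_def]]
  obtain \<delta>1 K1 where \<delta>1: "0 < \<delta>1"
    "\<forall>d. 0 < d \<and> d < \<delta>1 \<longrightarrow> laplace_point (six_spin \<beta> h) (1 / 2) (- D (2 * 2) (1 / 2) / fact (2 * 2)) K1 d 2"
    by (rule laplace[of 2 "1 / 2"]) (use D_half D4 in auto)
  obtain \<delta>2 K2 where \<delta>2: "0 < \<delta>2"
    "\<forall>d. 0 < d \<and> d < \<delta>2 \<longrightarrow> laplace_point (six_spin \<beta> h) (95 / 100) (- D (2 * 1) (95 / 100) / fact (2 * 1)) K2 d 1"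
    by (rule laplace[of 1 "95 / 100"]) (use D_95 D2 in auto)
  \<comment> \<open>One threshold for both maximizers, since concentration uses the same radius
    around each.\<close>
  define \<delta>0 where "\<delta>0 = min \<delta>1 \<delta>2"
  have \<delta>0: "0 < \<delta>0" using \<delta>1 \<delta>2 by (simp add: \<delta>0_def)
  have L1: "laplace_point (six_spin \<beta> h) (1 / 2) (- D (2 * 2) (1 / 2) / fact (2 * 2)) K1 d 2"
    and L2: "laplace_point (six_spin \<beta> h) (95 / 100) (- D (2 * 1) (95 / 100) / fact (2 * 1)) K2 d 1"
    if "0 < d" "d < \<delta>0" for d
    using \<delta>1 \<delta>2 that by (auto simp: \<delta>0_def)
  have weak: "weak_conv_m (\<lambda>n. distr (gibbs (six_spin \<beta> h) n) borel (\<lambda>\<omega>. magnetization n \<omega> / real n)) (return borel 0)"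
  proof (rule weak_conv_magnetization[OF \<delta>0])
    fix d assume d: "0 < d" "d < \<delta>0"
    show "(\<lambda>n. measure (gibbs (six_spin \<beta> h) n) {\<omega> \<in> configs n. frac_plus n \<omega> \<in> {x. d \<le> \<bar>x - 1 / 2\<bar>}}) \<longlonglongrightarrow> 0"
    proof (rule concentration_at_flatter_maximum[OF L1[OF d] L2[OF d]])
      show "continuous_on {0..1} (six_spin \<beta> h)"
        unfolding six_spin_def[abs_def] by (intro continuous_intros) auto
      have v: "six_spin \<beta> h (1 / 2) + entropy_I (1 / 2) = ln 2" "six_spin \<beta> h (95 / 100) + entropy_I (95 / 100) = ln 2"
        using six_spin_max(2)[of "1 / 2"] six_spin_max(2)[of "95 / 100"] by simp_all
      then show "six_spin \<beta> h (95 / 100) + entropy_I (95 / 100) = six_spin \<beta> h (1 / 2) + entropy_I (1 / 2)" by simp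
      show "six_spin \<beta> h x + entropy_I x < six_spin \<beta> h (1 / 2) + entropy_I (1 / 2)"
        if "0 \<le> x" "x \<le> 1" "x \<noteq> 1 / 2" "x \<noteq> 95 / 100" for x
        unfolding v using six_spin_max[of x] that by linarith
    qed simp
  qed
  have W1: "\<exists>C. \<forall>\<^sub>F n in sequentially.
          wasserstein
            (cond_law (six_spin \<beta> h) n {1 / 2 - \<delta> <..< 1 / 2 + \<delta>}
              (\<lambda>\<omega>. real n powr (- 3 / 4) * magnetization n \<omega>))
            (proportional_law (\<lambda>x. exp ((deriv ^^ 4) A (1 / 2) * x ^ 4 / (2 ^ 4 * fact 4))))
          \<le> ennreal (C * real n powr (- 1 / 4))" if \<delta>: "0 < \<delta>" "\<delta> < \<delta>0" for \<delta>
  proof -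
    interpret L: laplace_point "six_spin \<beta> h" "1 / 2" "- D (2 * 2) (1 / 2) / fact (2 * 2)" K1 \<delta> 2 by (rule L1[OF \<delta>])
    have scale: "L.scale n = real n powr (- 1 / 4)" for n unfolding L.scale_def by simp
    have law: "quasi_gaussian (- D (2 * 2) (1 / 2) / fact (2 * 2)) 2 = (\<lambda>x. exp ((deriv ^^ 4) A (1 / 2) * x ^ 4 / (2 ^ 4 * fact 4)))"
      by (simp add: quasi_gaussian_def fun_eq_iff D power_divide)
    show ?thesis
      unfolding law[symmetric] scale[symmetric]
    proof (rule L.wasserstein_cond_law)
      fix n :: nat and \<omega> assume n: "1 \<le> n" and \<omega>: "\<omega> \<in> configs n"
      \<comment> \<open>As the magnetization is \<open>n\<close> times twice the deviation of
        \<open>frac_plus\<close>, the factor left after rescaling is \<open>n powr (1 / 4)\<close>,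
        the inverse of the scale.\<close>
      have "real n powr (- 3 / 4) * real n = real n powr (- 3 / 4) * real n powr 1" using n by simp
      also have "\<dots> = real n powr (1 / 4)" by (simp only: powr_add[symmetric]) simp
      also have "\<dots> = 1 / L.scale n" by (simp add: scale powr_minus_divide)
      finally have p: "real n powr (- 3 / 4) * real n = 1 / L.scale n" .
      have "magnetization n \<omega> = real n * (2 * (frac_plus n \<omega> - 1 / 2))"
        using n by (simp add: magnetization_num_plus[OF \<omega>] frac_plus_num_plus field_simps)
      then show "real n powr (- 3 / 4) * magnetization n \<omega> = 2 * (frac_plus n \<omega> - 1 / 2) / L.scale n"
        by (simp only: mult.assoc[symmetric] p) simp
    qed
  qed
  have W2: "\<exists>C. \<forall>\<^sub>F n in sequentially.
          wasserstein
            (cond_law (six_spin \<beta> h) n {95 / 100 - \<delta> <..< 95 / 100 + \<delta>}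
              (\<lambda>\<omega>. (magnetization n \<omega> - 9 / 10 * real n) / sqrt (real n)))
            (centered_normal (4 / \<bar>(deriv ^^ 2) A (95 / 100)\<bar>))
          \<le> ennreal (C * real n powr (- 1 / 2))" if \<delta>: "0 < \<delta>" "\<delta> < \<delta>0" for \<delta>
  proof -
    interpret L: laplace_point "six_spin \<beta> h" "95 / 100" "- D (2 * 1) (95 / 100) / fact (2 * 1)" K2 \<delta> 1 by (rule L2[OF \<delta>])
    have scale: "L.scale n = real n powr (- 1 / 2)" for n unfolding L.scale_def by simp
    have law: "centered_normal (4 / \<bar>(deriv ^^ 2) A (95 / 100)\<bar>) = proportional_law (quasi_gaussian (- D (2 * 1) (95 / 100) / fact (2 * 1)) 1)"
      using centered_normal_eq_quasi_gaussian[OF D2] by (simp add: D)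
    show ?thesis
      unfolding law scale[symmetric]
    proof (rule L.wasserstein_cond_law)
      fix n :: nat and \<omega> assume n: "1 \<le> n" and \<omega>: "\<omega> \<in> configs n"
      define r where "r = sqrt (real n)"
      have r: "0 < r" "real n = r * r" using n by (simp_all add: r_def)
      have sc: "L.scale n = 1 / r" using n unfolding scale r_def by (simp add: powr_minus_divide powr_half_sqrt)
      \<comment> \<open>The centering is consistent because
        \<open>2 * (95 / 100) - 1 = 9 / 10\<close>.\<close>
      have "magnetization n \<omega> - 9 / 10 * real n = real n * (2 * (frac_plus n \<omega> - 95 / 100))"
        using n by (simp add: magnetization_num_plus[OF \<omega>] frac_plus_num_plus field_simps)
      also have "\<dots> / r = 2 * (frac_plus n \<omega> - 95 / 100) / (1 / r)"
        unfolding r(2) using r(1) by simp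
      finally show "(magnetization n \<omega> - 9 / 10 * real n) / sqrt (real n) = 2 * (frac_plus n \<omega> - 95 / 100) / L.scale n"
        unfolding sc r_def .
    qed
  qed
  show ?thesis
    using max reg1 reg2 weak \<delta>0 W1 W2 by blast
qed

end
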